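(* Let $m_1,\ldots,m_n$ be non-negative integers, not all zero, and let $D\subset\mathbb C^n$ be an $(m_1,\ldots,m_n)$-balanced pseudoconvex domain. Assume that $\psi$ is a complex geodesic in $D$ of the form $\psi(\lambda)=(\lambda^{m_1}\phi_1(\lambda),\ldots,\lambda^{m_n}\phi_n(\lambda))$, $\lambda\in\mathbb D$, where $\phi_1,\ldots,\phi_n$ are holomorphic on $\mathbb D$. Then, with $\phi=(\phi_1,\ldots,\phi_n)$, either $\phi(\mathbb D)\subset\partial D$ (i.e. $\phi\in\mathcal O(\mathbb D,\partial D)$) or $\phi$ is a complex geodesic in $D$.
   Context: $\mathbb D$ is the open unit disc. A domain $D\subset\mathbb C^n$ is $(m_1,\ldots,m_n)$-balanced if for every $z\in D$ and every $\lambda\in\overline{\mathbb D}$ the point $(\lambda^{m_1}z_1,\ldots,\lambda^{m_n}z_n)$ lies in $D$. A complex geodesic in $D$ is a holomorphic map $f:\mathbb D\to D$ for which there exists a holomorphic $F:D\to\mathbb D$ with $F\circ f=\mathrm{id}_{\mathbb D}$. *)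

theory Defs
  imports "HOL-Analysis.Analysis"
begin

definition domain_Cn :: "(complex ^ 'n) set \<Rightarrow> bool" where
  "domain_Cn D \<longleftrightarrow> open D \<and> connected D \<and> D \<noteq> {}"

definition balanced_wrt :: "('n \<Rightarrow> nat) \<Rightarrow> (complex ^ 'n) set \<Rightarrow> bool" where
  "balanced_wrt m D \<longleftrightarrow>
     (\<forall>z\<in>D. \<forall>l::complex. cmod l \<le> 1 \<longrightarrow> (\<chi> i. l ^ m i * z $ i) \<in> D)"

definition complex_linear_map :: "(complex ^ 'n \<Rightarrow> complex) \<Rightarrow> bool" where
  "complex_linear_map L \<longleftrightarrow> linear L \<and> (\<forall>c x. L (c *s x) = c * L x)"

definition holo_Cn_on :: "(complex ^ 'n \<Rightarrow> complex) \<Rightarrow> (complex ^ 'n) set \<Rightarrow> bool" where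
  "holo_Cn_on F D \<longleftrightarrow>
     (\<forall>z\<in>D. \<exists>L. (F has_derivative L) (at z) \<and> complex_linear_map L)"

definition holo_disc_map :: "(complex \<Rightarrow> complex ^ 'n) \<Rightarrow> bool" where
  "holo_disc_map f \<longleftrightarrow> (\<forall>i. (\<lambda>l. f l $ i) holomorphic_on ball 0 1)"

definition complex_geodesic :: "(complex ^ 'n) set \<Rightarrow> (complex \<Rightarrow> complex ^ 'n) \<Rightarrow> bool" where
  "complex_geodesic D f \<longleftrightarrow>
     holo_disc_map f \<and> f ` ball 0 1 \<subseteq> D \<and>
     (\<exists>F. holo_Cn_on F D \<and> F ` D \<subseteq> ball 0 1 \<and> (\<forall>l\<in>ball 0 1. F (f l) = l))"

definition cont_psh_on :: "(complex ^ 'n \<Rightarrow> real) \<Rightarrow> (complex ^ 'n) set \<Rightarrow> bool" where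
  "cont_psh_on u D \<longleftrightarrow> continuous_on D u \<and>
     (\<forall>z w r. r > 0 \<longrightarrow> (\<forall>\<zeta>. cmod \<zeta> \<le> r \<longrightarrow> z + \<zeta> *s w \<in> D) \<longrightarrow>
        u z \<le> integral {0..2*pi} (\<lambda>t. u (z + (of_real r * exp (\<i> * of_real t)) *s w)) / (2*pi))"

definition pseudoconvex :: "(complex ^ 'n) set \<Rightarrow> bool" where
  "pseudoconvex D \<longleftrightarrow> domain_Cn D \<and>
     (\<exists>u. cont_psh_on u D \<and> (\<forall>c. compact (closure {z\<in>D. u z < c}) \<and> closure {z\<in>D. u z < c} \<subseteq> D))"

end

theory Submission
  imports Defs "HOL-Complex_Analysis.Complex_Analysis"
begin

unbundle no fps_syntax

text \<open>
  Write \<open>\<lambda> \<cdot> z\<close> for \<open>(\<lambda>^m\<^sub>1 z\<^sub>1, \<dots>, \<lambda>^m\<^sub>n z\<^sub>n)\<close> and let \<open>F\<close> be a left inverse of \<open>\<psi>(\<lambda>) = \<lambda> \<cdot> \<phi>(\<lambda>)\<close>.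

  If \<open>\<phi>\<close> maps into \<open>D\<close>, then for \<open>z \<in> D\<close> the map \<open>\<lambda> \<mapsto> F(\<lambda> \<cdot> z)\<close> sends the closed disc into the open disc, so
  it has a unique fixed point \<open>G(z)\<close>, with derivative different from 1 there. By the implicit function
  theorem \<open>G\<close> is holomorphic, and \<open>G(\<phi>(\<lambda>)) = \<lambda>\<close> because \<open>F(\<lambda> \<cdot> \<phi>(\<lambda>)) = \<lambda>\<close>.

  That \<open>\<phi>\<close> maps into the closure of \<open>D\<close> and meets either only \<open>D\<close> or only its boundary follows from the
  continuity principle for the discs \<open>t \<cdot> f\<close>, \<open>0 \<le> t \<le> 1\<close>: if the boundary of \<open>f\<close> and the disc \<open>0 \<cdot> f\<close> lie
  in \<open>D\<close>, so does \<open>f\<close>. Taking \<open>f = r \<cdot> \<phi>\<close> on the disc of radius \<open>r\<close> gives the closure; taking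
  \<open>f = exp(\<epsilon> g) \<cdot> \<phi>\<close> near a boundary point of \<open>\<phi>\<^sup>-\<^sup>1(D)\<close>, with \<open>g\<close> the barrier of Hopf's lemma, gives the
  dichotomy.

  The exhaustion function is only continuous and satisfies the mean value inequality only on affine
  discs. For the maximum principle on \<open>f(\<lambda>) = f(\<lambda>\<^sub>0) + a (\<lambda> - \<lambda>\<^sub>0) + O(\<bar>\<lambda> - \<lambda>\<^sub>0\<bar>\<^sup>2)\<close> it is mollified to a strictly
  differentiable function; its differential annihilates the quadratic remainder on average over
  circles, and the error is \<open>o(\<bar>\<lambda> - \<lambda>\<^sub>0\<bar>\<^sup>2)\<close>.
\<close>

section \<open>Fixed points of holomorphic self-maps of the disc\<close>

text \<open>Conjugation by a disc automorphism moves \<open>p\<close> to 0, where the Schwarz lemma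
  applies. A second fixed point, or derivative 1 at \<open>p\<close>, would make the conjugate
  \<open>k\<close> a rotation; then \<open>h\<close> would map onto the whole disc, contrary to
  \<open>q < 1\<close>.\<close>

lemma holomorphic_fixed_point_strict:
  fixes h :: "complex \<Rightarrow> complex"
  assumes holh: "h holomorphic_on ball 0 1"
    and bound: "\<And>z. z \<in> ball 0 1 \<Longrightarrow> cmod (h z) \<le> q" and "q < 1"
    and p: "p \<in> ball 0 1" "h p = p"
  shows "\<And>z. z \<in> ball 0 1 \<Longrightarrow> h z = z \<Longrightarrow> z = p" and "deriv h p \<noteq> 1"
proof -
  obtain M N where M0: "M p = 0"
    and holM: "M holomorphic_on ball 0 1" and M1: "M ` ball 0 1 \<subseteq> ball 0 1"
    and holN: "N holomorphic_on ball 0 1" and N1: "N ` ball 0 1 \<subseteq> ball 0 1"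
    and MN: "\<And>z. z \<in> ball 0 1 \<Longrightarrow> M (N z) = z"
    and NM: "\<And>z. z \<in> ball 0 1 \<Longrightarrow> N (M z) = z"
    using ball_biholomorphism_exists[OF p(1)] by metis
  have h1: "h ` ball 0 1 \<subseteq> ball 0 1"
    using bound \<open>q < 1\<close> by (force simp: image_subset_iff)
  define k where "k = M \<circ> (h \<circ> N)"
  have N0: "N 0 = p"
    using NM[OF p(1)] M0 by simp
  have holk: "k holomorphic_on ball 0 1"
    unfolding k_def
    by (intro holomorphic_on_compose_gen[OF _ holM] holomorphic_on_compose_gen[OF holN holh])
      (use N1 h1 in auto)
  have k0: "k 0 = 0"
    by (simp add: k_def N0 p M0)
  have k1: "cmod (k z) < 1" if "cmod z < 1" for z
    using that N1 h1 M1 by (auto simp: k_def image_subset_iff)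
  have norot: "\<not> (\<exists>\<alpha>. (\<forall>z. cmod z < 1 \<longrightarrow> k z = \<alpha> * z) \<and> cmod \<alpha> = 1)"
  proof
    assume "\<exists>\<alpha>. (\<forall>z. cmod z < 1 \<longrightarrow> k z = \<alpha> * z) \<and> cmod \<alpha> = 1"
    then obtain \<alpha> where \<alpha>: "\<And>z. cmod z < 1 \<Longrightarrow> k z = \<alpha> * z" "cmod \<alpha> = 1" by blast
    \<comment> \<open>\<open>s\<close> is a point of the disc of modulus above \<open>q\<close>,
      hence outside the image of \<open>h\<close>, yet a rotation \<open>k\<close> would make
      \<open>h\<close> attain it. The maximum with 0 makes \<open>s\<close> positive without a prior
      proof of \<open>q \<ge> 0\<close>.\<close>
    define s :: complex where "s = of_real ((max 0 q + 1) / 2)"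
    have s: "cmod s < 1" "cmod s > q"
      using \<open>q < 1\<close> by (auto simp: s_def norm_divide)
    define y where "y = M s / \<alpha>"
    have y: "cmod y < 1"
      using M1 s \<alpha> by (auto simp: y_def norm_divide image_subset_iff)
    have hN: "h (N y) \<in> ball 0 1"
      using y N1 h1 by (auto simp: image_subset_iff)
    have "k y = M s"
      using \<alpha> y by (auto simp: y_def)
    then have "N (M (h (N y))) = N (M s)"
      by (simp add: k_def)
    then have "h (N y) = s"
      using NM[OF hN] NM[of s] s by simp
    moreover have "cmod (h (N y)) \<le> q"
      using y N1 by (intro bound) (auto simp: image_subset_iff)
    ultimately show False using s by simp
  qed
  note SL = Schwarz_Lemma(3)[OF holk k0 k1, of 0]
  show "z = p" if z: "z \<in> ball 0 1" "h z = z" for z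
  proof (rule ccontr)
    assume "z \<noteq> p"
    have "M z \<noteq> 0"
      using NM[OF z(1)] N0 \<open>z \<noteq> p\<close> by auto
    moreover have "k (M z) = M z"
      using NM[OF z(1)] z(2) by (simp add: k_def)
    moreover have "cmod (M z) < 1"
      using M1 z by (auto simp: image_subset_iff)
    ultimately show False
      using SL norot by fastforce
  qed
  show "deriv h p \<noteq> 1"
  proof
    assume d: "deriv h p = 1"
    have D: "(f has_field_derivative deriv f z) (at z)" if "f holomorphic_on ball 0 1" "z \<in> ball 0 1" for f z
      using that holomorphic_derivI[of f "ball 0 1" z] by simp
    have DN: "(N has_field_derivative deriv N 0) (at 0)"
      using D[OF holN, of 0] by simp
    have Dh: "(h has_field_derivative 1) (at (N 0))"
      using D[OF holh p(1)] d N0 by simp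
    have DM: "(M has_field_derivative deriv M p) (at p)"
      using D[OF holM p(1)] by simp
    have "((h \<circ> N) has_field_derivative 1 * deriv N 0) (at 0)"
      by (rule DERIV_chain[OF Dh DN])
    then have "(k has_field_derivative deriv M p * (1 * deriv N 0)) (at 0)"
      unfolding k_def using DM by (intro DERIV_chain[of M _ "h \<circ> N"]) (auto simp: N0 p)
    \<comment> \<open>Differentiating \<open>M (N z) = z\<close> shows that the outer derivatives of
      the conjugation cancel, so \<open>k\<close> has derivative 1 at 0.\<close>
    moreover have "((M \<circ> N) has_field_derivative deriv M p * deriv N 0) (at 0)"
      using DM DN by (intro DERIV_chain) (auto simp: N0)
    then have "((\<lambda>z. z) has_field_derivative deriv M p * deriv N 0) (at 0)"
      by (rule has_field_derivative_transform_within_open[of _ _ _ "ball 0 1"]) (auto simp: MN)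
    then have "deriv M p * deriv N 0 = 1"
      using DERIV_ident DERIV_unique by blast
    ultimately have "deriv k 0 = 1"
      by (simp add: DERIV_imp_deriv)
    then show False
      using SL norot by simp
  qed
qed

text \<open>Subtracting the fixed-point equations at \<open>x\<close> and \<open>z\<close> gives
  \<open>(1 - \<alpha>) * k = A h + o(norm k + norm h)\<close> with \<open>k = g x - g z\<close> and
  \<open>h = x - z\<close>. Since \<open>\<alpha> \<noteq> 1\<close>, the error in \<open>k\<close>
  is absorbed on the left. Because \<open>g\<close> is known to be continuous, differentiability of
  \<open>P\<close> at one point is enough.\<close>

lemma implicit_fixed_point_has_derivative:
  fixes P :: "complex \<times> 'a::real_normed_vector \<Rightarrow> complex" and g :: "'a \<Rightarrow> complex"
  assumes derP: "(P has_derivative (\<lambda>(k, h). \<alpha> * k + A h)) (at (g z, z))"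
    and "\<alpha> \<noteq> 1" and A: "bounded_linear A"
    and cont: "isCont g z"
    and fix_pt: "eventually (\<lambda>x. P (g x, x) = g x) (nhds z)"
  shows "(g has_derivative (\<lambda>h. A h / (1 - \<alpha>))) (at z)"
proof -
  interpret A: bounded_linear A by fact
  obtain C where C: "C > 0" "\<And>h. norm (A h) \<le> norm h * C"
    using A.pos_bounded by blast
  define c where "c = cmod (1 - \<alpha>)"
  have "c > 0" using \<open>\<alpha> \<noteq> 1\<close> by (simp add: c_def)
  have gz: "P (g z, z) = g z"
    using fix_pt by (rule eventually_nhds_x_imp_x)
  have "\<exists>d>0. \<forall>x. norm (x - z) < d \<longrightarrow>
      norm (g x - g z - A (x - z) / (1 - \<alpha>)) \<le> e * norm (x - z)" if "e > 0" for e
  proof -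
    \<comment> \<open>\<open>K\<close> will bound \<open>norm k\<close> by
      \<open>K * norm h\<close>: an error factor of at most \<open>c / 2\<close> leaves half of
      \<open>c * norm k\<close> on the left. The second bound on \<open>e'\<close> turns the
      remaining error into \<open>e * norm h\<close>.\<close>
    define K where "K = 2 * (C + c) / c"
    have "K > 0" using \<open>c > 0\<close> C by (simp add: K_def)
    define e' where "e' = min (c / 2) (e * c / (K + 1))"
    have e': "e' > 0" "e' \<le> c / 2" "e' \<le> e * c / (K + 1)"
      using \<open>c > 0\<close> \<open>e > 0\<close> \<open>K > 0\<close> unfolding e'_def
      by (simp, intro min.cobounded1, intro min.cobounded2)
    obtain d1 where d1: "d1 > 0"
      "\<And>y. norm (y - (g z, z)) < d1 \<Longrightarrow>
        norm (P y - P (g z, z) - (\<lambda>(k, h). \<alpha> * k + A h) (y - (g z, z))) \<le> e' * norm (y - (g z, z))"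
      using derP e'(1) unfolding has_derivative_at_alt by metis
    have "((\<lambda>x. (g x, x)) \<longlongrightarrow> (g z, z)) (nhds z)"
      using cont by (intro tendsto_Pair) (auto simp: continuous_at tendsto_at_iff_tendsto_nhds filterlim_ident)
    then have "eventually (\<lambda>x. dist (g x, x) (g z, z) < d1) (nhds z)"
      using d1(1) by (rule tendstoD)
    with fix_pt have "eventually (\<lambda>x. dist (g x, x) (g z, z) < d1 \<and> P (g x, x) = g x) (nhds z)"
      by eventually_elim auto
    then obtain d where d: "d > 0" "\<And>x. dist x z < d \<Longrightarrow> dist (g x, x) (g z, z) < d1 \<and> P (g x, x) = g x"
      unfolding eventually_nhds_metric by metis
    show ?thesis
    proof (intro exI[of _ d] conjI allI impI d(1))
      fix x assume "norm (x - z) < d"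
      define k where "k = g x - g z"
      define h where "h = x - z"
      define R where "R = (1 - \<alpha>) * k - A h"
      have P: "P (g x, x) = g x" and near: "norm ((g x, x) - (g z, z)) < d1"
        using d(2)[of x] \<open>norm (x - z) < d\<close> by (auto simp: dist_norm)
      have "norm R \<le> e' * norm (k, h)"
        using d1(2)[OF near] by (simp add: R_def k_def h_def P gz algebra_simps)
      also have "norm (k, h) \<le> norm k + norm h"
        by (rule norm_Pair_le)
      finally have R: "norm R \<le> e' * (norm k + norm h)"
        using e' by (simp add: mult_left_mono)
      have "c * norm k = norm (A h + R)"
        by (simp add: R_def c_def norm_mult)
      also have "\<dots> \<le> norm h * C + e' * (norm k + norm h)"
        using C(2)[of h] R norm_triangle_ineq[of "A h" R] by linarith
      also have "\<dots> \<le> norm h * C + c / 2 * (norm k + norm h)"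
        using mult_right_mono[OF e'(2), of "norm k + norm h"] by simp
      finally have "c * norm k \<le> 2 * (C + c) * norm h - c * norm h"
        by (simp add: field_simps)
      moreover have "c * norm h \<ge> 0" using \<open>c > 0\<close> by simp
      ultimately have "c * norm k \<le> 2 * (C + c) * norm h" by linarith
      then have k: "norm k \<le> K * norm h"
        using \<open>c > 0\<close> by (simp add: K_def field_simps)
      have "c * norm (k - A h / (1 - \<alpha>)) = norm R"
      proof -
        have "R = (1 - \<alpha>) * (k - A h / (1 - \<alpha>))"
          using \<open>\<alpha> \<noteq> 1\<close> by (simp add: R_def right_diff_distrib)
        then show ?thesis by (simp add: c_def norm_mult)
      qed
      also have "\<dots> \<le> e' * ((K + 1) * norm h)"
      proof -
        have "norm k + norm h \<le> (K + 1) * norm h"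
          using k by (simp add: distrib_right)
        then show ?thesis
          using R mult_left_mono[of "norm k + norm h" "(K + 1) * norm h" e'] e'(1) by linarith
      qed
      also have "\<dots> \<le> e * c / (K + 1) * ((K + 1) * norm h)"
        using e' \<open>K > 0\<close> by (intro mult_right_mono) auto
      also have "\<dots> = c * (e * norm h)"
        using \<open>K > 0\<close> by simp
      finally show "norm (g x - g z - A (x - z) / (1 - \<alpha>)) \<le> e * norm (x - z)"
        using \<open>c > 0\<close> by (simp add: k_def h_def)
    qed
  qed
  moreover have "bounded_linear (\<lambda>h. A h / (1 - \<alpha>))"
    using bounded_linear_compose[OF bounded_linear_divide A] by (simp add: o_def)
  ultimately show ?thesis
    unfolding has_derivative_at_alt by auto
qed

section \<open>Cancelling the weighted action\<close>

definition wact :: "('n \<Rightarrow> nat) \<Rightarrow> complex \<Rightarrow> complex ^ 'n \<Rightarrow> complex ^ 'n" where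
  "wact m l z = (\<chi> i. l ^ m i * z $ i)"

lemma wact_nth [simp]: "wact m l z $ i = l ^ m i * z $ i"
  by (simp add: wact_def)

lemma wact_one [simp]: "wact m 1 z = z"
  by (simp add: vec_eq_iff)

lemma wact_wact: "wact m k (wact m l z) = wact m (k * l) z"
  by (simp add: vec_eq_iff power_mult_distrib)

lemma continuous_on_wact [continuous_intros]:
  assumes "continuous_on S f" "continuous_on S g"
  shows "continuous_on S (\<lambda>x. wact m (f x) (g x))"
  unfolding wact_def using assms by (intro continuous_intros)

lemma balanced_wrt_wact: "balanced_wrt m D \<Longrightarrow> z \<in> D \<Longrightarrow> cmod l \<le> 1 \<Longrightarrow> wact m l z \<in> D"
  by (simp add: balanced_wrt_def wact_def)

lemma holo_disc_map_imp_continuous_on: "holo_disc_map f \<Longrightarrow> continuous_on (ball 0 1) f"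
proof -
  assume "holo_disc_map f"
  then have "continuous_on (ball 0 1) (\<lambda>x. \<chi> i. f x $ i)"
    unfolding holo_disc_map_def by (intro continuous_intros holomorphic_on_imp_continuous_on) auto
  then show ?thesis by simp
qed

lemma has_derivative_cart_componentwise:
  fixes f :: "'a::real_normed_vector \<Rightarrow> 'b::euclidean_space ^ 'n"
  assumes "\<And>i. ((\<lambda>x. f x $ i) has_derivative (\<lambda>h. f' h $ i)) (at a within S)"
  shows "(f has_derivative f') (at a within S)"
  unfolding has_derivative_componentwise_within[of f]
  using assms by (auto simp: Basis_vec_def inner_axis intro!: has_derivative_inner_left)

text \<open>For \<open>m i = 0\<close> the truncated exponent \<open>m i - 1\<close> does no harm,
  since its term carries the factor \<open>of_nat (m i) = 0\<close>.\<close>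

lemma has_derivative_wact:
  "((\<lambda>x. wact m (fst x) (snd x)) has_derivative
     (\<lambda>(k, h). k *s (\<chi> i. of_nat (m i) * l ^ (m i - 1) * z $ i) + wact m l h)) (at (l, z))"
proof (rule has_derivative_cart_componentwise)
  fix i
  have "((\<lambda>x::complex. x ^ m i) has_derivative (\<lambda>k. of_nat (m i) * l ^ (m i - 1) * k)) (at l)"
    by (rule has_field_derivative_imp_has_derivative) (auto intro!: derivative_eq_intros)
  then have 1: "((\<lambda>x::complex \<times> (complex ^ 'a). fst x ^ m i) has_derivative
      (\<lambda>k. of_nat (m i) * l ^ (m i - 1) * fst k)) (at (l, z))"
    by (intro has_derivative_compose[of fst fst "(l, z)" UNIV "\<lambda>x. x ^ m i", simplified])
      (auto intro!: derivative_eq_intros)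
  have 2: "((\<lambda>x::complex \<times> (complex ^ 'a). snd x $ i) has_derivative (\<lambda>h. snd h $ i)) (at (l, z))"
    by (intro bounded_linear_imp_has_derivative bounded_linear_intros)
      (auto intro!: bounded_linear_compose[OF bounded_linear_vec_nth bounded_linear_snd])
  show "((\<lambda>x. wact m (fst x) (snd x) $ i) has_derivative
      (\<lambda>x. (case x of (k, h) \<Rightarrow> k *s (\<chi> i. of_nat (m i) * l ^ (m i - 1) * z $ i) + wact m l h) $ i))
      (at (l, z))"
    using has_derivative_mult[OF 1 2]
    by (simp add: case_prod_unfold algebra_simps)
qed

lemma complex_linear_map_vector_linear:
  assumes "complex_linear_map L"
  shows "L (c *s x) = c * L x" "L (x + y) = L x + L y" "bounded_linear L"
  using assms by (auto simp: complex_linear_map_def linear_add linear_conv_bounded_linear)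

text \<open>For the fixed-point map \<open>G\<close>, Brouwer's theorem gives existence, the Schwarz
  lemma uniqueness, a closed graph continuity, and the linearised equation a complex linear
  derivative.\<close>

lemma complex_geodesic_wact_cancel:
  fixes D :: "(complex ^ 'n::finite) set"
  assumes "open D" and bal: "balanced_wrt m D"
    and \<phi>: "holo_disc_map \<phi>" "\<phi> ` ball 0 1 \<subseteq> D"
    and geo: "complex_geodesic D (\<lambda>l. wact m l (\<phi> l))"
  shows "complex_geodesic D \<phi>"
proof -
  obtain F where F: "holo_Cn_on F D" "F ` D \<subseteq> ball 0 1"
    and Fl: "\<And>l. l \<in> ball 0 1 \<Longrightarrow> F (wact m l (\<phi> l)) = l"
    using geo unfolding complex_geodesic_def by blast
  have F1: "cmod (F z) < 1" if "z \<in> D" for z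
    using F(2) that by (force simp: image_subset_iff)
  define P where "P = (\<lambda>x. F (wact m (fst x) (snd x)))"
  have actD: "wact m l z \<in> D" if "z \<in> D" "cmod l \<le> 1" for l z
    using balanced_wrt_wact[OF bal] that by blast
  have contF: "continuous_on D F"
    using F(1) \<open>open D\<close> unfolding holo_Cn_on_def
    by (meson continuous_at_imp_continuous_on has_derivative_continuous)
  have contP: "continuous_on (cball 0 1 \<times> D) P"
    unfolding P_def
    by (rule continuous_on_compose2[OF contF]) (auto intro!: continuous_intros actD)
  have derP: "\<exists>\<alpha> A. (P has_derivative (\<lambda>(k, h). \<alpha> * k + A h)) (at (l, z)) \<and> complex_linear_map A"
    if z: "z \<in> D" and l: "cmod l \<le> 1" for l z
  proof -
    obtain L where L: "(F has_derivative L) (at (wact m l z))" "complex_linear_map L"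
      using F(1) actD[OF z l] unfolding holo_Cn_on_def by blast
    note lin = complex_linear_map_vector_linear[OF L(2)]
    define q where "q = (\<chi> i. of_nat (m i) * l ^ (m i - 1) * z $ i)"
    have "((\<lambda>x. wact m (fst x) (snd x)) has_derivative (\<lambda>(k, h). k *s q + wact m l h)) (at (l, z))"
      unfolding q_def by (rule has_derivative_wact)
    then have "(P has_derivative (\<lambda>x. L (case x of (k, h) \<Rightarrow> k *s q + wact m l h))) (at (l, z))"
      unfolding P_def using L(1) by (intro has_derivative_compose[where f = "\<lambda>x. wact m (fst x) (snd x)" and g = F]) auto
    then have "(P has_derivative (\<lambda>(k, h). L q * k + L (wact m l h))) (at (l, z))"
      by (simp add: case_prod_unfold lin mult.commute)
    moreover have "linear (wact m l)"
      by (rule linearI) (auto simp: vec_eq_iff algebra_simps)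
    then have "linear (\<lambda>h. L (wact m l h))"
      using L(2) linear_compose[of "wact m l" L] by (simp add: complex_linear_map_def o_def)
    moreover have "wact m l (c *s x) = c *s wact m l x" for c x
      by (simp add: vec_eq_iff)
    ultimately show ?thesis
      using lin(1) unfolding complex_linear_map_def by metis
  qed
  have derP1: "((\<lambda>k. P (k, z)) has_field_derivative \<alpha>) (at l)"
    if "(P has_derivative (\<lambda>(k, h). \<alpha> * k + A h)) (at (l, z))" "complex_linear_map A" for \<alpha> A l z
  proof -
    have A0: "A 0 = 0" using that(2) by (simp add: complex_linear_map_def linear_0)
    have der: "((\<lambda>k. (k, z)) has_derivative (\<lambda>k. (k, 0))) (at l)"
      by (auto intro!: derivative_eq_intros)
    have "((\<lambda>k. P (k, z)) has_derivative (\<lambda>k. (\<lambda>(k, h). \<alpha> * k + A h) (k, 0))) (at l)"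
      by (rule has_derivative_compose[OF der that(1)])
    then show ?thesis
      by (simp add: A0 has_field_derivative_def)
  qed
  have holP: "(\<lambda>k. P (k, z)) holomorphic_on ball 0 1" if "z \<in> D" for z
    unfolding holomorphic_on_def field_differentiable_def
    using derP derP1 that by (metis has_field_derivative_at_within less_imp_le mem_ball_0)
  \<comment> \<open>Balancedness admits factors on the unit circle as well, so compactness of the
    closed disc gives, for each fixed \<open>z\<close>, the uniform bound below 1 that the
    fixed-point lemma asks for.\<close>
  have Pbound: "\<exists>q<1. \<forall>l\<in>cball 0 1. cmod (P (l, z)) \<le> q" if z: "z \<in> D" for z
  proof -
    have "continuous_on (cball 0 1) (\<lambda>l. cmod (P (l, z)))"
      by (intro continuous_intros continuous_on_compose2[OF contP]) (use z in auto)
    then obtain x where x: "x \<in> cball 0 1" "\<And>l. l \<in> cball 0 1 \<Longrightarrow> cmod (P (l, z)) \<le> cmod (P (x, z))"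
      using continuous_attains_sup[of "cball 0 1" "\<lambda>l. cmod (P (l, z))"] by fastforce
    moreover have "cmod (P (x, z)) < 1"
      using x z by (auto simp: P_def intro!: F1 actD)
    ultimately show ?thesis by blast
  qed
  have P1: "cmod (P (l, z)) < 1" if "z \<in> D" "cmod l \<le> 1" for l z
    using Pbound[OF that(1)] that(2) by force
  have uniq: "l = k" if "z \<in> D" "cmod l \<le> 1" "cmod k \<le> 1" "P (l, z) = l" "P (k, z) = k" for l k z
  proof -
    obtain q where "q < 1" "\<forall>l\<in>cball 0 1. cmod (P (l, z)) \<le> q"
      using Pbound \<open>z \<in> D\<close> by blast
    moreover have "l \<in> ball 0 1" "k \<in> ball 0 1"
      using P1[of z l] P1[of z k] that by auto
    ultimately show ?thesis
      using holomorphic_fixed_point_strict(1)[OF holP[OF \<open>z \<in> D\<close>], of q k l] that by auto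
  qed
  have "\<exists>l. cmod l < 1 \<and> P (l, z) = l" if z: "z \<in> D" for z
  proof -
    have "continuous_on (cball 0 1) (\<lambda>l. P (l, z))"
      by (intro continuous_on_compose2[OF contP] continuous_intros) (use z in auto)
    then obtain l where "l \<in> cball 0 1" "P (l, z) = l"
      using P1[OF z] brouwer[of "cball 0 1" "\<lambda>l. P (l, z)"]
      by (auto simp: less_imp_le)
    then show ?thesis
      using P1[OF z, of l] by auto
  qed
  then obtain G where G: "\<And>z. z \<in> D \<Longrightarrow> cmod (G z) < 1" "\<And>z. z \<in> D \<Longrightarrow> P (G z, z) = G z"
    by metis
  have contG: "continuous_on D G"
  proof -
    \<comment> \<open>A map into a compact set is continuous once its graph is closed; by uniqueness
      the graph is the zero set of the continuous function \<open>P (l, z) - l\<close>.\<close>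
    have "closedin (top_of_set (D \<times> cball 0 1)) ((\<lambda>x. (x, G x)) ` D)"
    proof -
      have "(\<lambda>x. (x, G x)) ` D = {x \<in> D \<times> cball 0 1. P (snd x, fst x) - snd x = 0}"
      proof (intro set_eqI iffI)
        fix y assume "y \<in> (\<lambda>x. (x, G x)) ` D"
        then show "y \<in> {x \<in> D \<times> cball 0 1. P (snd x, fst x) - snd x = 0}"
          using G by (auto simp: less_imp_le)
      next
        fix y assume "y \<in> {x \<in> D \<times> cball 0 1. P (snd x, fst x) - snd x = 0}"
        then have y: "fst y \<in> D" "cmod (snd y) \<le> 1" "P (snd y, fst y) = snd y"
          by auto
        have "snd y = G (fst y)"
          by (rule uniq[OF y(1,2) less_imp_le[OF G(1)[OF y(1)]] y(3) G(2)[OF y(1)]])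
        then show "y \<in> (\<lambda>x. (x, G x)) ` D"
          using y(1) by (intro image_eqI[of _ _ "fst y"]) (auto simp: prod_eq_iff)
      qed
      moreover have "closedin (top_of_set (D \<times> cball 0 1)) {x \<in> D \<times> cball 0 1. P (snd x, fst x) - snd x = 0}"
        by (rule continuous_closedin_preimage_constant)
          (auto intro!: continuous_on_diff continuous_on_snd continuous_on_fst continuous_on_id
            continuous_on_Pair continuous_on_compose2[OF contP])
      ultimately show ?thesis by simp
    qed
    then show ?thesis
      using continuous_closed_graph_eq[of "cball 0 1" G D] G(1) by (auto simp: less_imp_le)
  qed
  have "\<exists>L. (G has_derivative L) (at z) \<and> complex_linear_map L" if z: "z \<in> D" for z
  proof -
    obtain \<alpha> A where A: "(P has_derivative (\<lambda>(k, h). \<alpha> * k + A h)) (at (G z, z))" "complex_linear_map A"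
      using derP[OF z] G(1)[OF z] by (meson less_imp_le)
    obtain q where q: "q < 1" "\<forall>l\<in>cball 0 1. cmod (P (l, z)) \<le> q"
      using Pbound z by blast
    have "deriv (\<lambda>k. P (k, z)) (G z) \<noteq> 1"
      using holomorphic_fixed_point_strict(2)[OF holP[OF z], of q "G z"] q G z by auto
    then have "\<alpha> \<noteq> 1"
      using derP1[OF A] DERIV_imp_deriv by blast
    moreover have "bounded_linear A"
      using A(2) complex_linear_map_vector_linear by blast
    moreover have "isCont G z"
      using contG \<open>open D\<close> z continuous_on_eq_continuous_at by blast
    moreover have "eventually (\<lambda>x. P (G x, x) = G x) (nhds z)"
      using eventually_nhds_in_open[OF \<open>open D\<close> z] by eventually_elim (use G in auto)
    ultimately have "(G has_derivative (\<lambda>h. A h / (1 - \<alpha>))) (at z)"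
      using A(1) implicit_fixed_point_has_derivative by blast
    moreover have "complex_linear_map (\<lambda>h. A h / (1 - \<alpha>))"
      using A(2) linear_compose[OF _ bounded_linear.linear[OF bounded_linear_divide[of "1 - \<alpha>"]], of A]
      by (simp add: complex_linear_map_def o_def)
    ultimately show ?thesis by blast
  qed
  moreover have "G (\<phi> l) = l" if l: "l \<in> ball 0 1" for l
  proof -
    have "\<phi> l \<in> D" "cmod l \<le> 1"
      using l \<phi>(2) by auto
    moreover have "P (l, \<phi> l) = l"
      using Fl[OF l] by (simp add: P_def)
    ultimately show ?thesis
      using uniq[OF _ less_imp_le[OF G(1)]] G(2) by blast
  qed
  ultimately show ?thesis
    using \<phi> G(1) unfolding complex_geodesic_def holo_Cn_on_def
    by (intro conjI exI[of _ G]) auto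
qed

section \<open>Mollification\<close>

text \<open>Cauchy's integral formula in the angular variable, the form of the circle means in
  \<open>cont_psh_on\<close>. Holomorphic terms vanishing at the centre thus average to 0.\<close>

lemma holomorphic_circle_mean:
  assumes g: "g holomorphic_on ball z R" and "0 < \<rho>" "\<rho> < R"
  shows "((\<lambda>t. g (z + of_real \<rho> * exp (\<i> * of_real t))) has_integral of_real (2 * pi) * g z) {0..2*pi}"
proof -
  have "((\<lambda>u. g u / (u - z)) has_contour_integral (2 * of_real pi * \<i> * g z)) (circlepath z \<rho>)"
    using assms by (intro Cauchy_integral_circlepath_simple holomorphic_on_subset[OF g]) auto
  then have "((\<lambda>t. g (z + \<rho> * cis t) / (z + \<rho> * cis t - z) * \<rho> * \<i> * cis t) has_integral
      (2 * of_real pi * \<i> * g z)) {0..2*pi}"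
    unfolding circlepath_def by (subst (asm) has_contour_integral_part_circlepath_iff) auto
  then have "((\<lambda>t. g (z + \<rho> * cis t) * \<i>) has_integral (2 * of_real pi * \<i> * g z)) {0..2*pi}"
    using \<open>0 < \<rho>\<close> by simp
  from has_integral_mult_right[OF this, of "-\<i>"] show ?thesis
    by (simp add: cis_conv_exp mult_ac)
qed

text \<open>A first-order estimate for the square of the positive part, whose derivative
  \<open>2 * max 0 c\<close> at \<open>c\<close> is Lipschitz in \<open>c\<close>.\<close>

lemma abs_square_pos_part_diff_le:
  fixes a b c :: real
  shows "\<bar>(max 0 a)\<^sup>2 - (max 0 b)\<^sup>2 - 2 * max 0 c * (a - b)\<bar> \<le> 4 * (\<bar>a - c\<bar> + \<bar>b - c\<bar>) * \<bar>a - b\<bar>"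
proof -
  define p where "p = max 0 c"
  have p: "0 \<le> p" "\<And>x. x \<le> 0 \<Longrightarrow> p \<le> \<bar>x - c\<bar>" "\<And>x. x \<ge> 0 \<Longrightarrow> \<bar>x - p\<bar> \<le> \<bar>x - c\<bar>"
    by (auto simp: p_def max_def)
  have key: "\<exists>s. (max 0 a)\<^sup>2 - (max 0 b)\<^sup>2 - 2 * p * (a - b) = s * (a - b) \<and>
      \<bar>s\<bar> \<le> 4 * (\<bar>a - c\<bar> + \<bar>b - c\<bar>)"
  proof (cases "a = b")
    case True
    then show ?thesis by (intro exI[of _ 0]) auto
  next
    case False
    consider "a \<ge> 0" "b \<ge> 0" | "a \<ge> 0" "b < 0" | "a < 0" "b \<ge> 0" | "a < 0" "b < 0" by linarith
    then show ?thesis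
    proof cases
      case 1
      have "\<bar>(a - p) + (b - p)\<bar> \<le> \<bar>a - c\<bar> + \<bar>b - c\<bar>"
        by (rule order_trans[OF abs_triangle_ineq add_mono]) (rule p(3)[OF 1(1)] p(3)[OF 1(2)])+
      also have "\<dots> \<le> 4 * (\<bar>a - c\<bar> + \<bar>b - c\<bar>)" by simp
      finally have "\<bar>(a - p) + (b - p)\<bar> \<le> 4 * (\<bar>a - c\<bar> + \<bar>b - c\<bar>)" .
      then show ?thesis
        using 1 by (intro exI[of _ "(a - p) + (b - p)"]) (auto simp: max_def power2_eq_square algebra_simps)
    next
      case 2
      \<comment> \<open>With signs \<open>a \<ge> 0 > b\<close> the difference quotient is
        \<open>a * a / (a - b)\<close>, which lies between 0 and \<open>a\<close>, while
        \<open>b < 0\<close> forces \<open>p \<le> \<bar>b - c\<bar>\<close>.\<close>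
      have "0 \<le> a * a / (a - b)" "a * a / (a - b) \<le> a"
        using 2 by (auto simp: divide_simps mult_left_mono)
      moreover have "\<bar>s - 2 * p\<bar> \<le> 4 * (\<bar>a - c\<bar> + \<bar>b - c\<bar>)" if "0 \<le> s" "s \<le> a" for s
        using that 2 p(1) p(2)[OF less_imp_le[OF 2(2)]] by (smt (verit))
      ultimately have "\<bar>a * a / (a - b) - 2 * p\<bar> \<le> 4 * (\<bar>a - c\<bar> + \<bar>b - c\<bar>)" by blast
      then show ?thesis
        using 2 by (intro exI[of _ "a * a / (a - b) - 2 * p"])
          (auto simp: max_def power2_eq_square left_diff_distrib)
    next
      case 3
      have "0 \<le> b * b / (b - a)" "b * b / (b - a) \<le> b"
        using 3 by (auto simp: divide_simps mult_left_mono)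
      moreover have "\<bar>s - 2 * p\<bar> \<le> 4 * (\<bar>a - c\<bar> + \<bar>b - c\<bar>)" if "0 \<le> s" "s \<le> b" for s
        using that 3 p(1) p(2)[OF less_imp_le[OF 3(1)]] by (smt (verit))
      ultimately have "\<bar>b * b / (b - a) - 2 * p\<bar> \<le> 4 * (\<bar>a - c\<bar> + \<bar>b - c\<bar>)" by blast
      moreover have "b * b / (b - a) * (a - b) = - (b * b)"
        using 3 by (simp add: divide_simps) (simp add: algebra_simps)
      ultimately show ?thesis
        using 3 by (intro exI[of _ "b * b / (b - a) - 2 * p"])
          (auto simp: max_def power2_eq_square left_diff_distrib)
    next
      case 4
      have "\<bar>- 2 * p\<bar> \<le> 4 * (\<bar>a - c\<bar> + \<bar>b - c\<bar>)"
        using p(1) p(2)[OF less_imp_le[OF 4(1)]] by (smt (verit))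
      then show ?thesis
        using 4 by (intro exI[of _ "- 2 * p"]) auto
    qed
  qed
  then obtain s where s: "(max 0 a)\<^sup>2 - (max 0 b)\<^sup>2 - 2 * p * (a - b) = s * (a - b)"
    "\<bar>s\<bar> \<le> 4 * (\<bar>a - c\<bar> + \<bar>b - c\<bar>)" by blast
  show ?thesis
    using mult_right_mono[OF s(2), of "\<bar>a - b\<bar>"] s(1) by (simp add: p_def abs_mult)
qed

text \<open>A radial kernel supported in the ball of radius \<open>d\<close>; squaring the positive
  part makes it continuously differentiable. It is not normalised, so its mass appears as a factor
  in later estimates.\<close>

definition bump :: "real \<Rightarrow> 'a::real_inner \<Rightarrow> real" where
  "bump d w = (max 0 (d\<^sup>2 - (norm w)\<^sup>2))\<^sup>2"

lemma bump_nonneg: "0 \<le> bump d w"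
  by (simp add: bump_def)

lemma bump_eq_0: "0 \<le> d \<Longrightarrow> d \<le> norm w \<Longrightarrow> bump d w = 0"
  by (simp add: bump_def)

lemma continuous_on_bump [continuous_intros]:
  "continuous_on S f \<Longrightarrow> continuous_on S (\<lambda>x. bump d (f x))"
  unfolding bump_def by (intro continuous_intros)

text \<open>The linear term is the derivative at \<open>z\<close> of
  \<open>\<lambda>x. bump d (w - x)\<close>. The error carries \<open>norm (x - y)\<close> as well
  as the distances of \<open>x\<close> and \<open>y\<close> to \<open>z\<close>, uniformly in
  \<open>w\<close>, and so becomes strict differentiability after integration.\<close>

lemma bump_diff_le:
  fixes w x y z :: "'a::real_inner"
  assumes N: "norm (w - z) \<le> N" and "norm (x - z) \<le> 1" "norm (y - z) \<le> 1"
  shows "\<bar>bump d (w - x) - bump d (w - y) - 4 * max 0 (d\<^sup>2 - (norm (w - z))\<^sup>2) * ((w - z) \<bullet> (x - y))\<bar>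
    \<le> (16 * (N + 1)\<^sup>2 + 2 * d\<^sup>2) * (norm (x - z) + norm (y - z)) * norm (x - y)"
proof -
  define a where "a = d\<^sup>2 - (norm (w - x))\<^sup>2"
  define b where "b = d\<^sup>2 - (norm (w - y))\<^sup>2"
  define c where "c = d\<^sup>2 - (norm (w - z))\<^sup>2"
  define E where "E = norm (x - z) + norm (y - z)"
  have "0 \<le> N" using N norm_ge_zero[of "w - z"] by linarith
  have sq: "\<bar>(norm (w - q))\<^sup>2 - (norm (w - p))\<^sup>2\<bar> \<le> 2 * (N + 1) * norm (p - q)"
    if "norm (p - z) \<le> 1" "norm (q - z) \<le> 1" for p q
  proof -
    have "(norm (w - q))\<^sup>2 - (norm (w - p))\<^sup>2 = (p - q) \<bullet> (2 *\<^sub>R (w - z) - (p - z) - (q - z))"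
      by (simp add: power2_norm_eq_inner algebra_simps inner_commute)
    moreover have "norm (2 *\<^sub>R (w - z) - (p - z) - (q - z)) \<le> 2 * (N + 1)"
      using norm_triangle_ineq4[of "2 *\<^sub>R (w - z) - (p - z)" "q - z"]
        norm_triangle_ineq4[of "2 *\<^sub>R (w - z)" "p - z"] N that by simp
    ultimately show ?thesis
      using Cauchy_Schwarz_ineq2[of "p - q" "2 *\<^sub>R (w - z) - (p - z) - (q - z)"]
        mult_left_mono[of "norm (2 *\<^sub>R (w - z) - (p - z) - (q - z))" "2 * (N + 1)" "norm (p - q)"]
      by (simp add: mult.commute)
  qed
  have ab: "\<bar>a - b\<bar> \<le> 2 * (N + 1) * norm (x - y)"
    using sq[of x y] assms by (simp add: a_def b_def)
  have "\<bar>a - c\<bar> \<le> 2 * (N + 1) * norm (x - z)" "\<bar>b - c\<bar> \<le> 2 * (N + 1) * norm (y - z)"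
    using sq[of x z] sq[of y z] assms by (simp_all add: a_def b_def c_def)
  then have ac: "\<bar>a - c\<bar> + \<bar>b - c\<bar> \<le> 2 * (N + 1) * E"
    by (simp add: E_def algebra_simps)
  have "a - b = 2 * ((w - z) \<bullet> (x - y)) + (x - y) \<bullet> ((z - x) + (z - y))"
    by (simp add: a_def b_def power2_norm_eq_inner algebra_simps inner_commute)
  moreover have "\<bar>(x - y) \<bullet> ((z - x) + (z - y))\<bar> \<le> E * norm (x - y)"
  proof -
    have "norm ((z - x) + (z - y)) \<le> E"
      using norm_triangle_ineq[of "z - x" "z - y"] by (simp add: E_def norm_minus_commute)
    then show ?thesis
      using Cauchy_Schwarz_ineq2[of "x - y" "(z - x) + (z - y)"]
        mult_left_mono[of "norm ((z - x) + (z - y))" E "norm (x - y)"]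
      by (simp add: mult.commute)
  qed
  ultimately have lin: "\<bar>(a - b) - 2 * ((w - z) \<bullet> (x - y))\<bar> \<le> E * norm (x - y)"
    by simp
  have c: "0 \<le> max 0 c" "max 0 c \<le> d\<^sup>2" by (auto simp: c_def)
  have "bump d (w - x) - bump d (w - y) - 4 * max 0 c * ((w - z) \<bullet> (x - y)) =
      ((max 0 a)\<^sup>2 - (max 0 b)\<^sup>2 - 2 * max 0 c * (a - b))
      + 2 * max 0 c * ((a - b) - 2 * ((w - z) \<bullet> (x - y)))"
    by (simp add: bump_def a_def b_def algebra_simps)
  also have "\<bar>\<dots>\<bar> \<le> 4 * (\<bar>a - c\<bar> + \<bar>b - c\<bar>) * \<bar>a - b\<bar>
      + 2 * max 0 c * \<bar>(a - b) - 2 * ((w - z) \<bullet> (x - y))\<bar>"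
    using abs_square_pos_part_diff_le[of a b c] c(1)
    by (intro order_trans[OF abs_triangle_ineq] add_mono) (auto simp: abs_mult)
  also have "\<dots> \<le> 4 * (2 * (N + 1) * E) * (2 * (N + 1) * norm (x - y)) + 2 * d\<^sup>2 * (E * norm (x - y))"
    using ab ac lin c \<open>0 \<le> N\<close> by (intro add_mono mult_mono) (auto simp: E_def)
  also have "\<dots> = (16 * (N + 1)\<^sup>2 + 2 * d\<^sup>2) * E * norm (x - y)"
    by (simp add: power2_eq_square algebra_simps)
  finally show ?thesis
    by (simp add: c_def E_def)
qed

text \<open>Convolution with \<open>bump d\<close>, not divided by the mass of the kernel. The box
  encloses the ball of radius \<open>d\<close>, outside of which the kernel vanishes, and lets the
  integration theorems for boxes apply.\<close>

definition mollify :: "real \<Rightarrow> ('a::euclidean_space \<Rightarrow> real) \<Rightarrow> 'a \<Rightarrow> real" where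
  "mollify d u z = integral (cbox (- d *\<^sub>R One) (d *\<^sub>R One)) (\<lambda>w. u (z + w) * bump d w)"

lemma cball_subset_cbox_One: "cball (0::'a::euclidean_space) d \<subseteq> cbox (- d *\<^sub>R One) (d *\<^sub>R One)"
  using order_trans[OF Basis_le_norm] by (fastforce simp: mem_box abs_le_iff)

lemma continuous_on_mollify:
  fixes u :: "'a::euclidean_space \<Rightarrow> real"
  assumes "continuous_on UNIV u"
  shows "continuous_on S (mollify d u)"
  unfolding mollify_def
  by (intro integral_continuous_on_param)
    (auto simp: case_prod_unfold intro!: continuous_intros continuous_on_compose2[OF assms])

text \<open>A translation moves the dependence on \<open>z\<close> from the merely continuous
  \<open>u\<close> into the kernel, which can be differentiated. One box then serves all nearby
  \<open>z\<close>.\<close>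

lemma mollify_eq_integral:
  fixes u :: "'a::euclidean_space \<Rightarrow> real"
  assumes u: "continuous_on UNIV u" and "0 \<le> d" and sub: "cball z d \<subseteq> cbox a b"
  shows "mollify d u z = integral (cbox a b) (\<lambda>w. u w * bump d (w - z))"
proof -
  have "((\<lambda>w. u w * bump d (w - z)) has_integral integral (cbox a b) (\<lambda>w. u w * bump d (w - z))) (cbox a b)"
    by (intro integrable_integral integrable_continuous continuous_intros continuous_on_subset[OF u]) auto
  from has_integral_affinity[OF this, of 1 z]
  have "((\<lambda>w. u (z + w) * bump d w) has_integral integral (cbox a b) (\<lambda>w. u w * bump d (w - z)))
      ((\<lambda>x. x - z) ` cbox a b)"
    by (simp add: add.commute)
  then have 1: "((\<lambda>w. u (z + w) * bump d w) has_integral integral (cbox a b) (\<lambda>w. u w * bump d (w - z))) UNIV"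
  proof (rule has_integral_on_superset)
    fix w assume w: "w \<notin> (\<lambda>x. x - z) ` cbox a b"
    have "z + w \<notin> cball z d"
      using w sub by (force simp: image_iff)
    then show "u (z + w) * bump d w = 0"
      using \<open>0 \<le> d\<close> by (simp add: bump_eq_0 dist_norm)
  qed auto
  have "((\<lambda>w. u (z + w) * bump d w) has_integral mollify d u z) (cbox (- d *\<^sub>R One) (d *\<^sub>R One))"
    unfolding mollify_def
    by (intro integrable_integral integrable_continuous continuous_intros continuous_on_compose2[OF u]) auto
  then have "((\<lambda>w. u (z + w) * bump d w) has_integral mollify d u z) UNIV"
  proof (rule has_integral_on_superset)
    fix w :: 'a assume "w \<notin> cbox (- d *\<^sub>R One) (d *\<^sub>R One)"
    then have "w \<notin> cball 0 d"
      using cball_subset_cbox_One by blast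
    then show "u (z + w) * bump d w = 0"
      using \<open>0 \<le> d\<close> by (simp add: bump_eq_0)
  qed auto
  with 1 show ?thesis
    using has_integral_unique by blast
qed

text \<open>The strict form compares two points near \<open>z\<close> with an error relative to
  their mutual distance. Between a holomorphic disc and its tangent affine disc that distance is
  quadratic in the radius, so the error is of smaller order than the squared radius; plain
  differentiability would only give an error of smaller order than the radius.\<close>

lemma mollify_strictly_differentiable:
  fixes u :: "'a::euclidean_space \<Rightarrow> real"
  assumes u: "continuous_on UNIV u" and "0 \<le> d"
  shows "\<exists>q. \<forall>e>0. \<exists>\<delta>>0. \<forall>x\<in>ball z \<delta>. \<forall>y\<in>ball z \<delta>.
    \<bar>mollify d u x - mollify d u y - q \<bullet> (x - y)\<bar> \<le> e * norm (x - y)"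
proof -
  obtain a b where ab: "cball z (d + 1) \<subseteq> cbox a b"
    by (metis bounded_cball bounded_subset_cbox_symmetric)
  have eq: "mollify d u x = integral (cbox a b) (\<lambda>w. u w * bump d (w - x))" if "norm (x - z) \<le> 1" for x
  proof (rule mollify_eq_integral[OF u \<open>0 \<le> d\<close>])
    have "cball x d \<subseteq> cball z (d + 1)"
      using that by (simp add: cball_subset_cball_iff dist_norm)
    then show "cball x d \<subseteq> cbox a b" using ab by blast
  qed
  have "bounded (u ` cbox a b)"
    using u by (intro compact_imp_bounded compact_continuous_image continuous_on_subset[OF u]) auto
  then obtain U where U: "U > 0" "\<And>w. w \<in> cbox a b \<Longrightarrow> \<bar>u w\<bar> \<le> U"
    unfolding bounded_pos by auto
  have "bounded ((\<lambda>w. w - z) ` cbox a b)"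
    by (intro compact_imp_bounded compact_continuous_image continuous_intros) auto
  then obtain N where N: "N > 0" "\<And>w. w \<in> cbox a b \<Longrightarrow> norm (w - z) \<le> N"
    unfolding bounded_pos by auto
  define C where "C = U * (16 * (N + 1)\<^sup>2 + 2 * d\<^sup>2)"
  have "C \<ge> 0" using U N by (simp add: C_def)
  \<comment> \<open>\<open>k\<close> is \<open>u\<close> times the gradient of the kernel in the
    centre, so its integral \<open>q\<close> is the gradient of the mollification at
    \<open>z\<close>.\<close>
  define k where "k = (\<lambda>w. (u w * (4 * max 0 (d\<^sup>2 - (norm (w - z))\<^sup>2))) *\<^sub>R (w - z))"
  define q where "q = integral (cbox a b) k"
  have k: "k integrable_on cbox a b"
    unfolding k_def by (intro integrable_continuous continuous_intros continuous_on_subset[OF u]) auto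
  have est: "\<bar>mollify d u x - mollify d u y - q \<bullet> (x - y)\<bar>
      \<le> C * (norm (x - z) + norm (y - z)) * norm (x - y) * measure lborel (cbox a b)"
    if xy: "norm (x - z) \<le> 1" "norm (y - z) \<le> 1" for x y
  proof -
    have "((\<lambda>w. u w * bump d (w - p)) has_integral mollify d u p) (cbox a b)" if "norm (p - z) \<le> 1" for p
      unfolding eq[OF that]
      by (intro integrable_integral integrable_continuous continuous_intros continuous_on_subset[OF u]) auto
    moreover have "((\<lambda>w. k w \<bullet> (x - y)) has_integral q \<bullet> (x - y)) (cbox a b)"
      using has_integral_linear[OF integrable_integral[OF k] bounded_linear_inner_left]
      by (simp add: q_def o_def)
    ultimately have "((\<lambda>w. u w * bump d (w - x) - u w * bump d (w - y) - k w \<bullet> (x - y)) has_integral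
        (mollify d u x - mollify d u y - q \<bullet> (x - y))) (cbox a b)"
      using xy by (intro has_integral_diff) auto
    then have "norm (mollify d u x - mollify d u y - q \<bullet> (x - y))
      \<le> C * (norm (x - z) + norm (y - z)) * norm (x - y) * measure lborel (cbox a b)"
    proof (rule has_integral_bound[rotated])
      fix w assume w: "w \<in> cbox a b"
      have "u w * bump d (w - x) - u w * bump d (w - y) - k w \<bullet> (x - y) =
        u w * (bump d (w - x) - bump d (w - y) - 4 * max 0 (d\<^sup>2 - (norm (w - z))\<^sup>2) * ((w - z) \<bullet> (x - y)))"
        by (simp add: k_def algebra_simps)
      also have "norm \<dots> \<le> U * ((16 * (N + 1)\<^sup>2 + 2 * d\<^sup>2) * (norm (x - z) + norm (y - z)) * norm (x - y))"
        unfolding real_norm_def abs_mult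
        using U w N xy by (intro mult_mono bump_diff_le) auto
      finally show "norm (u w * bump d (w - x) - u w * bump d (w - y) - k w \<bullet> (x - y))
          \<le> C * (norm (x - z) + norm (y - z)) * norm (x - y)"
        by (simp add: C_def mult.assoc)
    qed (use \<open>C \<ge> 0\<close> in auto)
    then show ?thesis by simp
  qed
  show ?thesis
  proof (intro exI[of _ q] allI impI)
    fix e :: real assume "e > 0"
    define C' where "C' = C * measure lborel (cbox a b)"
    have "C' \<ge> 0" using \<open>C \<ge> 0\<close> by (simp add: C'_def)
    define \<delta> where "\<delta> = min 1 (e / (2 * (C' + 1)))"
    have "\<delta> > 0" using \<open>e > 0\<close> \<open>C' \<ge> 0\<close> by (simp add: \<delta>_def)
    moreover have "\<bar>mollify d u x - mollify d u y - q \<bullet> (x - y)\<bar> \<le> e * norm (x - y)"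
      if "x \<in> ball z \<delta>" "y \<in> ball z \<delta>" for x y
    proof -
      have n: "norm (x - z) \<le> \<delta>" "norm (y - z) \<le> \<delta>" "\<delta> \<le> 1" "\<delta> \<le> e / (2 * (C' + 1))"
        using that by (auto simp: dist_norm norm_minus_commute \<delta>_def)
      have "C' * (norm (x - z) + norm (y - z)) \<le> (C' + 1) * (2 * (e / (2 * (C' + 1))))"
        using n \<open>C' \<ge> 0\<close> by (intro mult_mono) auto
      also have "\<dots> = e" using \<open>C' \<ge> 0\<close> by (simp add: divide_simps)
      finally have "C' * (norm (x - z) + norm (y - z)) * norm (x - y) \<le> e * norm (x - y)"
        by (intro mult_right_mono) auto
      moreover have "norm (x - z) \<le> 1" "norm (y - z) \<le> 1"
        using n by linarith+
      ultimately show ?thesis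
        using est[of x y] by (simp add: C'_def mult_ac)
    qed
    ultimately show "\<exists>\<delta>>0. \<forall>x\<in>ball z \<delta>. \<forall>y\<in>ball z \<delta>.
        \<bar>mollify d u x - mollify d u y - q \<bullet> (x - y)\<bar> \<le> e * norm (x - y)"
      by blast
  qed
qed

section \<open>The maximum principle on holomorphic discs\<close>

lemma norm_vector_smult: "norm (c *s x) = cmod c * norm (x :: complex ^ 'n)"
  by (simp add: norm_vec_def norm_mult L2_set_right_distrib)

lemma continuous_on_vector_smult [continuous_intros]:
  fixes g :: "'a::topological_space \<Rightarrow> complex ^ 'n"
  assumes "continuous_on S f" "continuous_on S g"
  shows "continuous_on S (\<lambda>x. f x *s g x)"
  unfolding vector_scalar_mult_def using assms by (intro continuous_intros)

text \<open>Fubini: the mean value inequality of \<open>u\<close> on the affine disc translated by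
  \<open>w\<close> is integrated against the nonnegative kernel. \<open>v\<close> is a globally
  continuous function agreeing with \<open>u\<close> where it matters, since \<open>mollify\<close>
  acts on functions on the whole space.\<close>

lemma mollify_sub_mean:
  fixes u v :: "complex ^ 'n \<Rightarrow> real"
  assumes psh: "cont_psh_on u D" and v: "continuous_on UNIV v" and "0 < r"
    and near: "\<And>w \<zeta>. norm w \<le> d \<Longrightarrow> cmod \<zeta> \<le> r \<Longrightarrow>
      z + w + \<zeta> *s a \<in> D \<and> v (z + w + \<zeta> *s a) = u (z + w + \<zeta> *s a)"
    and "0 \<le> d"
  shows "2 * pi * mollify d v z \<le>
    integral {0..2*pi} (\<lambda>t. mollify d v (z + (of_real r * exp (\<i> * of_real t)) *s a))"
proof -
  define E where "E = (\<lambda>t::real. of_real r * exp (\<i> * of_real t))"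
  define B where "B = cbox (- d *\<^sub>R One :: complex ^ 'n) (d *\<^sub>R One)"
  have contE: "continuous_on S (\<lambda>x. E (f x))" if "continuous_on S f" for S and f :: "'b::topological_space \<Rightarrow> real"
    unfolding E_def using that by (intro continuous_intros)
  have normE: "cmod (E t) \<le> r" for t
    using \<open>0 < r\<close> by (simp add: E_def norm_mult)
  define J where "J = (\<lambda>w. integral {0..2*pi} (\<lambda>t. v (z + E t *s a + w) * bump d w))"
  have contv: "continuous_on S (\<lambda>x. v (f x))" if "continuous_on S f" for S and f :: "'b::topological_space \<Rightarrow> complex ^ 'n"
    using that by (rule continuous_on_compose2[OF v]) auto
  have "integral {0..2*pi} (\<lambda>t. mollify d v (z + E t *s a)) = integral B J"
    unfolding mollify_def B_def J_def box_real(2)[symmetric]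
    by (rule integral_swap_continuous)
      (auto simp: case_prod_unfold intro!: continuous_intros contv contE)
  moreover have "2 * pi * mollify d v z = integral B (\<lambda>w. 2 * pi * (v (z + w) * bump d w))"
    by (simp add: mollify_def B_def)
  moreover have "integral B (\<lambda>w. 2 * pi * (v (z + w) * bump d w)) \<le> integral B J"
  proof (rule integral_le)
    show "(\<lambda>w. 2 * pi * (v (z + w) * bump d w)) integrable_on B"
      unfolding B_def by (intro integrable_continuous continuous_intros contv)
    show "J integrable_on B"
      unfolding B_def J_def box_real(2)[symmetric]
      by (intro integrable_continuous integral_continuous_on_param)
        (auto simp: case_prod_unfold intro!: continuous_intros contv contE)
    fix w
    show "2 * pi * (v (z + w) * bump d w) \<le> J w"
    proof (cases "norm w \<le> d")
      case False
      then show ?thesis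
        using \<open>0 \<le> d\<close> by (simp add: J_def bump_eq_0)
    next
      case True
      have "u (z + w) \<le> integral {0..2*pi} (\<lambda>t. u (z + w + E t *s a)) / (2 * pi)"
        unfolding E_def
        using psh near[OF True] \<open>0 < r\<close> unfolding cont_psh_on_def by blast
      moreover have "u (z + w) = v (z + w)"
        using near[OF True, of 0] \<open>0 < r\<close> by simp
      moreover have "u (z + w + E t *s a) = v (z + E t *s a + w)" for t
        using near[OF True normE] by (metis add.assoc add.commute)
      ultimately have "2 * pi * v (z + w) \<le> integral {0..2*pi} (\<lambda>t. v (z + E t *s a + w))"
        by (simp add: divide_simps mult.commute)
      then show ?thesis
        using bump_nonneg[of d w] by (simp add: J_def mult_right_mono flip: mult.assoc)
    qed
  qed
  ultimately show ?thesis
    by (simp add: E_def)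
qed

lemma holomorphic_second_order:
  assumes g: "g holomorphic_on S" "open S" "z \<in> S"
  obtains C s where "s > 0" "cball z s \<subseteq> S"
    "\<And>\<zeta>. cmod \<zeta> \<le> s \<Longrightarrow> cmod (g (z + \<zeta>) - g z - \<zeta> * deriv g z) \<le> C * (cmod \<zeta>)\<^sup>2"
proof -
  obtain s where s: "s > 0" "cball z s \<subseteq> S"
    using g open_contains_cball by blast
  have g': "deriv g holomorphic_on S" "deriv (deriv g) holomorphic_on S"
    using g by (auto intro: holomorphic_deriv)
  have "bounded (deriv (deriv g) ` cball z s)"
    using s g' by (intro compact_imp_bounded compact_continuous_image holomorphic_on_imp_continuous_on
      holomorphic_on_subset[OF g'(2)]) auto
  then obtain C where C: "\<And>x. x \<in> cball z s \<Longrightarrow> cmod (deriv (deriv g) x) \<le> C"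
    unfolding bounded_iff by blast
  show ?thesis
  proof (rule that[OF s])
    fix \<zeta> :: complex assume \<zeta>: "cmod \<zeta> \<le> s"
    have "cmod ((deriv ^^ 0) g (z + \<zeta>) - (\<Sum>i\<le>1. (deriv ^^ i) g z * (z + \<zeta> - z) ^ i / fact i))
        \<le> C * cmod (z + \<zeta> - z) ^ Suc 1 / fact 1"
    proof (rule complex_Taylor[where S = "cball z s" and f = "\<lambda>i. (deriv ^^ i) g"])
      fix i :: nat and x assume "x \<in> cball z s" "i \<le> 1"
      then have "(deriv ^^ i) g holomorphic_on S" "x \<in> S"
        using s g by (auto intro: holomorphic_higher_deriv)
      then show "((deriv ^^ i) g has_field_derivative (deriv ^^ Suc i) g x) (at x within cball z s)"
        using holomorphic_derivI[OF _ g(2)] by simp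
    qed (use C s \<zeta> in \<open>auto simp: dist_norm\<close>)
    then show "cmod (g (z + \<zeta>) - g z - \<zeta> * deriv g z) \<le> C * (cmod \<zeta>)\<^sup>2"
      by (simp add: numeral_2_eq_2 mult_ac diff_diff_add)
  qed
qed

lemma holomorphic_vector_second_order:
  fixes f :: "complex \<Rightarrow> complex ^ 'n"
  assumes f: "\<And>i. (\<lambda>l. f l $ i) holomorphic_on S" and "open S" "z \<in> S"
  obtains a C s where "s > 0" "C \<ge> 0" "cball z s \<subseteq> S"
    "\<And>\<zeta>. cmod \<zeta> \<le> s \<Longrightarrow> norm (f (z + \<zeta>) - f z - \<zeta> *s a) \<le> C * (cmod \<zeta>)\<^sup>2"
proof -
  define a where "a = (\<chi> i. deriv (\<lambda>l. f l $ i) z)"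
  have "\<forall>i. \<exists>C s. s > 0 \<and> cball z s \<subseteq> S \<and>
    (\<forall>\<zeta>. cmod \<zeta> \<le> s \<longrightarrow> cmod ((f (z + \<zeta>) - f z - \<zeta> *s a) $ i) \<le> C * (cmod \<zeta>)\<^sup>2)"
  proof
    fix i
    show "\<exists>C s. s > 0 \<and> cball z s \<subseteq> S \<and>
      (\<forall>\<zeta>. cmod \<zeta> \<le> s \<longrightarrow> cmod ((f (z + \<zeta>) - f z - \<zeta> *s a) $ i) \<le> C * (cmod \<zeta>)\<^sup>2)"
      by (rule holomorphic_second_order[OF f[of i] assms(2,3)]) (auto simp: a_def)
  qed
  then obtain C s where Cs: "\<And>i. s i > 0" "\<And>i. cball z (s i) \<subseteq> S"
    "\<And>i \<zeta>. cmod \<zeta> \<le> s i \<Longrightarrow> cmod ((f (z + \<zeta>) - f z - \<zeta> *s a) $ i) \<le> C i * (cmod \<zeta>)\<^sup>2"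
    by metis
  define s0 where "s0 = Min (range s)"
  have s0: "s0 > 0" "\<And>i. s0 \<le> s i"
    using Cs(1) by (auto simp: s0_def)
  show ?thesis
  proof (rule that[of s0 "\<Sum>i\<in>UNIV. \<bar>C i\<bar>" a])
    show "s0 > 0" by fact
    show "0 \<le> (\<Sum>i\<in>UNIV. \<bar>C i\<bar>)" by (simp add: sum_nonneg)
    \<comment> \<open>\<open>undefined\<close> serves as an arbitrary index; index types are
      nonempty.\<close>
    show "cball z s0 \<subseteq> S"
      using Cs(2)[of undefined] s0(2)[of undefined] by (meson order_trans subset_cball)
    fix \<zeta> :: complex assume \<zeta>: "cmod \<zeta> \<le> s0"
    have "norm (f (z + \<zeta>) - f z - \<zeta> *s a) \<le> (\<Sum>i\<in>UNIV. cmod ((f (z + \<zeta>) - f z - \<zeta> *s a) $ i))"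
      unfolding norm_vec_def by (rule L2_set_le_sum) auto
    also have "\<dots> \<le> (\<Sum>i\<in>UNIV. \<bar>C i\<bar> * (cmod \<zeta>)\<^sup>2)"
    proof (rule sum_mono)
      fix i
      have "cmod ((f (z + \<zeta>) - f z - \<zeta> *s a) $ i) \<le> C i * (cmod \<zeta>)\<^sup>2"
        using \<zeta> s0(2)[of i] by (intro Cs(3)) linarith
      also have "\<dots> \<le> \<bar>C i\<bar> * (cmod \<zeta>)\<^sup>2"
        by (intro mult_right_mono) auto
      finally show "cmod ((f (z + \<zeta>) - f z - \<zeta> *s a) $ i) \<le> \<bar>C i\<bar> * (cmod \<zeta>)\<^sup>2" .
    qed
    finally show "norm (f (z + \<zeta>) - f z - \<zeta> *s a) \<le> (\<Sum>i\<in>UNIV. \<bar>C i\<bar>) * (cmod \<zeta>)\<^sup>2"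
      by (simp add: sum_distrib_right)
  qed
qed

text \<open>At a maximum \<open>z\<close>, values on a small circle of the disc are compared with
  those on the tangent affine circle. The penalty contributes \<open>\<epsilon> * \<rho>^2\<close>,
  strict differentiability costs at most half of that, and the terms \<open>q \<bullet> Q t\<close>
  and \<open>W t\<close> have mean zero. Averaging contradicts the mean value inequality of the
  mollification.\<close>

lemma mollify_holomorphic_no_strict_local_max:
  fixes f :: "complex \<Rightarrow> complex ^ 'n" and u v :: "complex ^ 'n \<Rightarrow> real"
  assumes psh: "cont_psh_on u D" and v: "continuous_on UNIV v" and "0 < d"
    and near: "\<And>x. dist (f z) x \<le> 2 * d \<Longrightarrow> x \<in> D \<and> v x = u x"
    and f: "\<And>i. (\<lambda>l. f l $ i) holomorphic_on S" and S: "open S" "z \<in> S" and "\<epsilon> > 0"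
  shows "\<exists>x\<in>S. mollify d v (f x) + \<epsilon> * (cmod (x - c))\<^sup>2 > mollify d v (f z) + \<epsilon> * (cmod (z - c))\<^sup>2"
proof (rule ccontr)
  assume "\<not> ?thesis"
  then have max: "mollify d v (f x) + \<epsilon> * (cmod (x - c))\<^sup>2 \<le> mollify d v (f z) + \<epsilon> * (cmod (z - c))\<^sup>2"
    if "x \<in> S" for x
    using that by (meson not_le)
  obtain s C a where s: "s > 0" "C \<ge> 0" "cball z s \<subseteq> S"
    and C: "\<And>\<zeta>. cmod \<zeta> \<le> s \<Longrightarrow> norm (f (z + \<zeta>) - f z - \<zeta> *s a) \<le> C * (cmod \<zeta>)\<^sup>2"
    by (rule holomorphic_vector_second_order[OF f S]) (rule that)
  define e where "e = \<epsilon> / (2 * (C + 1))"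
  have "e > 0" using \<open>\<epsilon> > 0\<close> s by (simp add: e_def)
  obtain q \<delta> where "\<delta> > 0" and q: "\<And>x y. x \<in> ball (f z) \<delta> \<Longrightarrow> y \<in> ball (f z) \<delta> \<Longrightarrow>
      \<bar>mollify d v x - mollify d v y - q \<bullet> (x - y)\<bar> \<le> e * norm (x - y)"
    using mollify_strictly_differentiable[OF v, of d "f z"] \<open>0 < d\<close> \<open>e > 0\<close> by (meson less_imp_le)
  define A where "A = norm a + 1"
  have "A > 0" by (simp add: A_def add_nonneg_pos)
  \<comment> \<open>The four bounds keep the second-order expansion valid, give
    \<open>\<rho> * \<rho> \<le> \<rho>\<close>, keep the affine disc thickened by \<open>d\<close>
    within \<open>2 * d\<close> of \<open>f z\<close>, and keep both compared points within
    \<open>\<delta>\<close> of it.\<close>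
  define \<rho> where "\<rho> = min (min (s / 2) 1) (min (d / A) (\<delta> / (2 * (A + C))))"
  have \<rho>: "0 < \<rho>" "\<rho> < s" "\<rho> \<le> 1" "\<rho> * A \<le> d" "\<rho> * (A + C) < \<delta>"
  proof -
    have "A + C > 0" using \<open>A > 0\<close> s by simp
    then show "0 < \<rho>"
      using s \<open>A > 0\<close> \<open>\<delta> > 0\<close> \<open>0 < d\<close> by (simp add: \<rho>_def)
    have "\<rho> \<le> d / A" "\<rho> \<le> \<delta> / (2 * (A + C))" "\<rho> \<le> s / 2" "\<rho> \<le> 1"
      unfolding \<rho>_def by (rule min.coboundedI2, rule min.cobounded1) (rule min.coboundedI2, rule min.cobounded2,
        rule min.coboundedI1, rule min.cobounded1, rule min.coboundedI1, rule min.cobounded2)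
    then have "\<rho> * A \<le> d" "\<rho> * (2 * (A + C)) \<le> \<delta>"
      using \<open>A > 0\<close> \<open>A + C > 0\<close> by (simp_all add: pos_le_divide_eq)
    then show "\<rho> * A \<le> d" "\<rho> * (A + C) < \<delta>"
      using \<open>\<delta> > 0\<close> by linarith+
    show "\<rho> < s" "\<rho> \<le> 1" using \<open>\<rho> \<le> s / 2\<close> \<open>\<rho> \<le> 1\<close> s by linarith+
  qed
  define E where "E = (\<lambda>t::real. of_real \<rho> * exp (\<i> * of_real t))"
  have E: "cmod (E t) = \<rho>" for t
    using \<rho> by (simp add: E_def norm_mult)
  \<comment> \<open>\<open>Q\<close> is the quadratic remainder of \<open>f\<close>, and
    \<open>W\<close> is the cross term in the expansion of the penalty.\<close>
  define Q where "Q = (\<lambda>t. f (z + E t) - f z - E t *s a)"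
  define W where "W = (\<lambda>t. 2 * \<epsilon> * Re (cnj (z - c) * E t))"
  have contE: "continuous_on {0..2*pi} E"
    unfolding E_def by (intro continuous_intros)
  have contf: "continuous_on S f"
  proof -
    have "continuous_on S (\<lambda>x. \<chi> i. f x $ i)"
      using f by (intro continuous_intros holomorphic_on_imp_continuous_on)
    then show ?thesis by simp
  qed
  have inS: "z + E t \<in> S" for t
    using s \<rho> E[of t] by (auto simp: dist_norm)
  have pointwise: "mollify d v (f z + E t *s a) \<le> mollify d v (f z) - \<epsilon> * \<rho>\<^sup>2 / 2 - q \<bullet> Q t - W t" for t
  proof -
    have nQ: "norm (Q t) \<le> C * \<rho>\<^sup>2"
      using C[of "E t"] \<rho> E by (simp add: Q_def)
    have nE: "norm (E t *s a) \<le> \<rho> * A"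
      using \<rho> by (simp add: norm_vector_smult E A_def)
    have "\<rho> * \<rho> \<le> \<rho>" using \<rho> by (simp add: mult_left_le)
    then have "norm (Q t) \<le> \<rho> * C"
      using nQ mult_left_mono[of "\<rho> * \<rho>" \<rho> C] s by (simp add: power2_eq_square mult.commute)
    moreover have "f (z + E t) - f z = E t *s a + Q t"
      by (simp add: Q_def)
    ultimately have "norm (f (z + E t) - f z) \<le> \<rho> * (A + C)"
      using norm_triangle_ineq[of "E t *s a" "Q t"] nE by (simp add: distrib_left)
    then have 1: "f (z + E t) \<in> ball (f z) \<delta>"
      using \<rho> by (simp add: dist_norm norm_minus_commute)
    have 2: "f z + E t *s a \<in> ball (f z) \<delta>"
    proof -
      have "\<rho> * A \<le> \<rho> * (A + C)" using \<rho> s by (intro mult_left_mono) auto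
      then have "norm (E t *s a) < \<delta>" using nE \<rho>(5) by linarith
      then show ?thesis by (simp add: dist_norm)
    qed
    have "\<bar>mollify d v (f (z + E t)) - mollify d v (f z + E t *s a) - q \<bullet> Q t\<bar> \<le> e * norm (Q t)"
      using q[OF 1 2] by (simp add: Q_def diff_diff_eq)
    also have "\<dots> \<le> e * (C * \<rho>\<^sup>2)"
      using nQ \<open>e > 0\<close> by simp
    also have "\<dots> \<le> \<epsilon> * \<rho>\<^sup>2 / 2"
    proof -
      have "e * C \<le> e * (C + 1)" using \<open>e > 0\<close> by simp
      also have "\<dots> = \<epsilon> / 2" using s by (simp add: e_def divide_simps)
      finally show ?thesis
        using mult_right_mono[of "e * C" "\<epsilon> / 2" "\<rho>\<^sup>2"] by simp
    qed
    finally have "\<bar>mollify d v (f (z + E t)) - mollify d v (f z + E t *s a) - q \<bullet> Q t\<bar> \<le> \<epsilon> * \<rho>\<^sup>2 / 2" .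
    moreover have "(cmod (z + E t - c))\<^sup>2 = (cmod (z - c))\<^sup>2 + \<rho>\<^sup>2 + 2 * Re (cnj (z - c) * E t)"
    proof -
      have "(cmod ((z - c) + E t))\<^sup>2 = (cmod (z - c))\<^sup>2 + (cmod (E t))\<^sup>2 + 2 * Re (cnj (z - c) * E t)"
        unfolding cmod_power2 by (simp add: power2_eq_square algebra_simps)
      moreover have "z + E t - c = (z - c) + E t" by simp
      ultimately show ?thesis by (simp only: E)
    qed
    then have "\<epsilon> * (cmod (z + E t - c))\<^sup>2 = \<epsilon> * (cmod (z - c))\<^sup>2 + \<epsilon> * \<rho>\<^sup>2 + W t"
      by (simp only: W_def ring_distribs mult_ac)
    ultimately show ?thesis
      using max[OF inS, of t] by linarith
  qed
  have intQ: "(Q has_integral 0) {0..2*pi}"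
  proof -
    have "continuous_on {0..2*pi} Q"
      unfolding Q_def
      by (intro continuous_intros contE continuous_on_compose2[OF contf]) (use inS in auto)
    then have Q: "Q integrable_on {0..2*pi}"
      using integrable_continuous_interval by blast
    have "integral {0..2*pi} Q $ i = 0" for i
    proof -
      \<comment> \<open>The remainder as a holomorphic function of \<open>l\<close>; it vanishes at
        \<open>z\<close>, so its circle mean is 0.\<close>
      define g where "g = (\<lambda>l. f l $ i - f z $ i - (l - z) * a $ i)"
      have "g holomorphic_on ball z s"
        unfolding g_def using s(3) by (intro holomorphic_intros holomorphic_on_subset[OF f]) auto
      from holomorphic_circle_mean[OF this \<rho>(1,2)]
      have "((\<lambda>t. Q t $ i) has_integral 0) {0..2*pi}"
        by (simp add: g_def Q_def E_def)
      from integral_unique[OF this] show ?thesis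
        using integral_linear[OF Q bounded_linear_vec_nth[of i]] by (simp add: o_def)
    qed
    then have "integral {0..2*pi} Q = 0" by (simp add: vec_eq_iff)
    then show ?thesis using Q integrable_integral by metis
  qed
  then have intqQ: "((\<lambda>t. q \<bullet> Q t) has_integral 0) {0..2*pi}"
    using has_integral_linear[OF intQ bounded_linear_inner_right[of q]] by (simp add: o_def)
  have intW: "(W has_integral 0) {0..2*pi}"
  proof -
    have "(\<lambda>l. cnj (z - c) * (l - z)) holomorphic_on ball z s"
      by (intro holomorphic_intros)
    from holomorphic_circle_mean[OF this \<rho>(1,2)]
    have "((\<lambda>t. cnj (z - c) * E t) has_integral 0) {0..2*pi}"
      by (simp add: E_def)
    from has_integral_linear[OF this bounded_linear_Re]
    have "((\<lambda>t. Re (cnj (z - c) * E t)) has_integral 0) {0..2*pi}"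
      by (simp only: o_def zero_complex.sel)
    from has_integral_mult_right[OF this, of "2 * \<epsilon>"] show ?thesis
      by (simp only: W_def mult_zero_right)
  qed
  have "2 * pi * mollify d v (f z) \<le>
    integral {0..2*pi} (\<lambda>t. mollify d v (f z + (of_real \<rho> * exp (\<i> * of_real t)) *s a))"
  proof (rule mollify_sub_mean[OF psh v \<rho>(1)])
    fix w :: "complex ^ 'n" and \<zeta> :: complex assume w: "norm w \<le> d" and \<zeta>: "cmod \<zeta> \<le> \<rho>"
    have "norm (\<zeta> *s a) \<le> \<rho> * A"
      unfolding norm_vector_smult using \<zeta> \<rho> by (intro mult_mono) (auto simp: A_def)
    then have "norm (w + \<zeta> *s a) \<le> 2 * d"
      using norm_triangle_ineq[of w "\<zeta> *s a"] w \<rho> by linarith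
    then show "f z + w + \<zeta> *s a \<in> D \<and> v (f z + w + \<zeta> *s a) = u (f z + w + \<zeta> *s a)"
      by (intro near) (metis add.assoc add_diff_cancel_left' dist_norm norm_minus_commute)
  qed (use \<open>0 < d\<close> in auto)
  also have "\<dots> \<le> 2 * pi * (mollify d v (f z) - \<epsilon> * \<rho>\<^sup>2 / 2)"
  proof (rule has_integral_le)
    have "continuous_on {0..2*pi} (\<lambda>t. mollify d v (f z + E t *s a))"
      by (intro continuous_on_compose2[OF continuous_on_mollify[OF v, of UNIV]] continuous_intros contE) auto
    then show "((\<lambda>t. mollify d v (f z + (of_real \<rho> * exp (\<i> * of_real t)) *s a)) has_integral
        integral {0..2*pi} (\<lambda>t. mollify d v (f z + (of_real \<rho> * exp (\<i> * of_real t)) *s a))) {0..2*pi}"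
      unfolding E_def by (intro integrable_integral integrable_continuous_interval)
    have "((\<lambda>t. mollify d v (f z) - \<epsilon> * \<rho>\<^sup>2 / 2) has_integral 2 * pi * (mollify d v (f z) - \<epsilon> * \<rho>\<^sup>2 / 2)) {0..2*pi}"
      using has_integral_const_real[of "mollify d v (f z) - \<epsilon> * \<rho>\<^sup>2 / 2" 0 "2 * pi"] by simp
    from has_integral_diff[OF has_integral_diff[OF this intqQ] intW]
    show "((\<lambda>t. mollify d v (f z) - \<epsilon> * \<rho>\<^sup>2 / 2 - q \<bullet> Q t - W t) has_integral
        2 * pi * (mollify d v (f z) - \<epsilon> * \<rho>\<^sup>2 / 2)) {0..2*pi}"
      by simp
  qed (use pointwise in \<open>simp add: E_def\<close>)
  finally show False
    using \<rho>(1) \<open>\<epsilon> > 0\<close> by (simp add: mult_le_0_iff)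
qed

text \<open>Up to the mass of the kernel, mollification is a weighted average over the ball of
  radius \<open>d\<close>, so it deviates from \<open>c\<close> by no more than \<open>v\<close>
  does there.\<close>

lemma mollify_approx:
  fixes v :: "'a::euclidean_space \<Rightarrow> real"
  assumes v: "continuous_on UNIV v" and "0 \<le> d"
    and close: "\<And>w. norm w \<le> d \<Longrightarrow> \<bar>v (z + w) - c\<bar> \<le> \<eta>"
  shows "\<bar>mollify d v z - c * integral (cbox (- d *\<^sub>R One) (d *\<^sub>R One)) (bump d :: 'a \<Rightarrow> real)\<bar>
    \<le> \<eta> * integral (cbox (- d *\<^sub>R One) (d *\<^sub>R One)) (bump d :: 'a \<Rightarrow> real)"
proof -
  define B where "B = cbox (- d *\<^sub>R One :: 'a) (d *\<^sub>R One)"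
  have int: "(\<lambda>w. v (z + w) * bump d w) integrable_on B" "(bump d :: 'a \<Rightarrow> real) integrable_on B"
    unfolding B_def by (intro integrable_continuous continuous_intros continuous_on_compose2[OF v]; auto)+
  have "mollify d v z - c * integral B (bump d) = integral B (\<lambda>w. v (z + w) * bump d w - c * bump d w)"
    unfolding mollify_def B_def[symmetric]
    using int by (subst integral_diff) (auto intro: integrable_on_mult_right)
  also have "norm \<dots> \<le> integral B (\<lambda>w. \<eta> * bump d w)"
  proof (rule integral_norm_bound_integral)
    fix w
    show "norm (v (z + w) * bump d w - c * bump d w) \<le> \<eta> * bump d w"
    proof (cases "norm w \<le> d")
      case True
      have "v (z + w) * bump d w - c * bump d w = (v (z + w) - c) * bump d w"
        by (simp add: algebra_simps)
      then show ?thesis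
        using mult_right_mono[OF close[OF True] bump_nonneg[of d w]] bump_nonneg[of d w]
        by (simp add: abs_mult)
    next
      case False
      then show ?thesis using \<open>0 \<le> d\<close> by (simp add: bump_eq_0)
    qed
  qed (unfold B_def, (intro integrable_continuous continuous_intros continuous_on_compose2[OF v]; auto)+)
  finally show ?thesis by (simp add: B_def)
qed

lemma integral_bump_pos:
  assumes "0 < d"
  shows "0 < integral (cbox (- d *\<^sub>R One) (d *\<^sub>R One)) (bump d :: 'a::euclidean_space \<Rightarrow> real)"
proof -
  define B where "B = cbox (- d *\<^sub>R One :: 'a) (d *\<^sub>R One)"
  have int: "(bump d has_integral integral B (bump d)) B"
    unfolding B_def by (intro integrable_integral integrable_continuous continuous_intros)
  have "0 \<le> integral B (bump d)"
    using has_integral_nonneg[OF int] bump_nonneg by blast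
  moreover have "integral B (bump d) \<noteq> 0"
  proof
    assume "integral B (bump d) = 0"
    then have "(bump d has_integral 0) (cbox (- d *\<^sub>R One :: 'a) (d *\<^sub>R One))"
      using int by (simp add: B_def)
    then have "bump d (0::'a) = 0"
    proof (rule has_integral_0_cbox_imp_0[rotated 2])
      show "continuous_on (cbox (- d *\<^sub>R One :: 'a) (d *\<^sub>R One)) (bump d)"
        by (rule continuous_on_bump[OF continuous_on_id])
    qed (use assms in \<open>simp_all add: bump_nonneg mem_box box_ne_empty\<close>)
    then show False using assms by (simp add: bump_def)
  qed
  ultimately show ?thesis by (simp add: B_def)
qed

text \<open>An interior value exceeding \<open>M\<close> by \<open>\<eta>\<close> survives
  mollification and a small quadratic penalty. The perturbed function then attains its maximum over
  the closed disc at an interior point, which \<open>mollify_holomorphic_no_strict_local_max\<close>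
  excludes.\<close>

lemma psh_holomorphic_maximum_principle:
  fixes f :: "complex \<Rightarrow> complex ^ 'n" and u :: "complex ^ 'n \<Rightarrow> real"
  assumes "open D" and psh: "cont_psh_on u D"
    and contf: "continuous_on (cball c r) f" and holf: "\<And>i. (\<lambda>l. f l $ i) holomorphic_on ball c r"
    and fD: "f ` cball c r \<subseteq> D"
    and bd: "\<And>l. l \<in> sphere c r \<Longrightarrow> u (f l) \<le> M"
    and l: "l \<in> cball c r"
  shows "u (f l) \<le> M"
proof (rule ccontr)
  assume "\<not> u (f l) \<le> M"
  define \<eta> where "\<eta> = u (f l) - M"
  have "\<eta> > 0" using \<open>\<not> u (f l) \<le> M\<close> by (simp add: \<eta>_def)
  define K where "K = f ` cball c r"
  have "compact K"
    unfolding K_def by (intro compact_continuous_image contf) auto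
  obtain s where s: "s > 0" "(\<Union>x\<in>K. cball x s) \<subseteq> D"
    using compact_subset_open_imp_cball_epsilon_subset[OF \<open>compact K\<close> \<open>open D\<close>] fD by (auto simp: K_def)
  \<comment> \<open>On this compact thickening of the image \<open>u\<close> is uniformly
    continuous, and Tietze's theorem extends it to a function that can be mollified.\<close>
  define K' where "K' = (\<Union>x\<in>K. cball x s)"
  have "compact K'"
    unfolding K'_def using \<open>compact K\<close> by (rule compact_minkowski_sum_cball)
  have contu: "continuous_on K' u"
    using psh s(2) unfolding cont_psh_on_def K'_def using continuous_on_subset by blast
  obtain \<delta> where "\<delta> > 0" and \<delta>: "\<And>x y. x \<in> K' \<Longrightarrow> y \<in> K' \<Longrightarrow> dist y x < \<delta> \<Longrightarrow> dist (u y) (u x) < \<eta> / 4"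
    using compact_uniformly_continuous[OF contu \<open>compact K'\<close>] \<open>\<eta> > 0\<close>
    unfolding uniformly_continuous_on_def by (metis divide_pos_pos zero_less_numeral)
  obtain v where v: "continuous_on UNIV v" "\<And>x. x \<in> K' \<Longrightarrow> v x = u x"
    using Tietze_unbounded[OF contu, of UNIV] \<open>compact K'\<close> compact_imp_closed by auto
  define d where "d = min (s / 2) (\<delta> / 2)"
  have d: "0 < d" "2 * d \<le> s" "d < \<delta>"
    using s \<open>\<delta> > 0\<close> by (auto simp: d_def)
  have inK': "y \<in> K'" if "x \<in> K" "dist x y \<le> 2 * d" for x y
    using that d unfolding K'_def by force
  define I where "I = integral (cbox (- d *\<^sub>R One) (d *\<^sub>R One)) (bump d :: complex ^ 'n \<Rightarrow> real)"
  have "I > 0"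
    unfolding I_def using d(1) by (rule integral_bump_pos)
  have approx: "\<bar>mollify d v x - u x * I\<bar> \<le> \<eta> / 4 * I" if "x \<in> K" for x
    unfolding I_def
  proof (rule mollify_approx[OF v(1)])
    fix w :: "complex ^ 'n" assume w: "norm w \<le> d"
    then have "x + w \<in> K'" "x \<in> K'"
      using d by (auto intro!: inK'[OF that] simp: dist_norm)
    then show "\<bar>v (x + w) - u x\<bar> \<le> \<eta> / 4"
      using \<delta>[of x "x + w"] v(2) w d by (simp add: dist_norm)
  qed (use d in auto)
  have "r \<ge> 0" using l zero_le_dist[of c l] by (simp only: mem_cball)
  \<comment> \<open>The excess \<open>\<eta> * I\<close> is divided into quarters: mollification
    costs at most one at \<open>l\<close> and adds at most one on the sphere, where the penalty adds
    at most another. Three quarters at \<open>l\<close> then exceed two on the sphere.\<close>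
  define \<epsilon> where "\<epsilon> = \<eta> * I / (4 * (r\<^sup>2 + 1))"
  have "r\<^sup>2 + 1 > 0" by (simp add: add_nonneg_pos)
  then have "\<epsilon> > 0" using \<open>\<eta> > 0\<close> \<open>I > 0\<close> by (simp add: \<epsilon>_def)
  have \<epsilon>r: "\<epsilon> * r\<^sup>2 \<le> \<eta> * I / 4"
  proof -
    have "\<epsilon> * r\<^sup>2 \<le> \<epsilon> * (r\<^sup>2 + 1)" using \<open>\<epsilon> > 0\<close> by simp
    also have "\<dots> = \<eta> * I / 4" using \<open>r\<^sup>2 + 1 > 0\<close> by (simp add: \<epsilon>_def divide_simps)
    finally show ?thesis .
  qed
  define h where "h = (\<lambda>x. mollify d v (f x) + \<epsilon> * (cmod (x - c))\<^sup>2)"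
  have "continuous_on (cball c r) h"
    unfolding h_def
    by (intro continuous_intros continuous_on_compose2[OF continuous_on_mollify[OF v(1), of UNIV] contf]) auto
  then obtain z where z: "z \<in> cball c r" "\<And>x. x \<in> cball c r \<Longrightarrow> h x \<le> h z"
    using continuous_attains_sup[of "cball c r" h] l by (metis compact_cball empty_iff)
  have "h l > M * I + \<eta> * I / 2"
  proof -
    have "mollify d v (f l) \<ge> u (f l) * I - \<eta> / 4 * I"
      using approx[OF imageI[OF l, of f, folded K_def]] by linarith
    moreover have "u (f l) * I = M * I + \<eta> * I" by (simp add: \<eta>_def algebra_simps)
    moreover have "\<epsilon> * (cmod (l - c))\<^sup>2 \<ge> 0" using \<open>\<epsilon> > 0\<close> by simp
    moreover have "\<eta> * I > 0" using \<open>\<eta> > 0\<close> \<open>I > 0\<close> by simp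
    moreover have "\<eta> / 4 * I = \<eta> * I / 4" by simp
    ultimately show ?thesis unfolding h_def by linarith
  qed
  moreover have "h x \<le> M * I + \<eta> * I / 2" if x: "x \<in> sphere c r" for x
  proof -
    have "mollify d v (f x) \<le> u (f x) * I + \<eta> / 4 * I"
      using approx[OF imageI[OF subsetD[OF sphere_cball x], of f, folded K_def]] by linarith
    moreover have "u (f x) * I \<le> M * I"
      using bd[OF x] \<open>I > 0\<close> by simp
    moreover have "cmod (x - c) = r" using x by (simp add: dist_norm norm_minus_commute)
    moreover have "\<eta> / 4 * I = \<eta> * I / 4" by simp
    ultimately show ?thesis using \<epsilon>r by (simp only: h_def)
  qed
  ultimately have "z \<notin> sphere c r"
    using z(2)[OF l] by force
  then have zb: "z \<in> ball c r" using z(1) by auto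
  have "\<exists>x\<in>ball c r. mollify d v (f x) + \<epsilon> * (cmod (x - c))\<^sup>2 > mollify d v (f z) + \<epsilon> * (cmod (z - c))\<^sup>2"
  proof (rule mollify_holomorphic_no_strict_local_max[OF psh v(1) d(1) _ holf _ zb \<open>\<epsilon> > 0\<close>])
    fix x assume "dist (f z) x \<le> 2 * d"
    then have "x \<in> K'"
      using inK'[OF imageI[OF z(1), of f, folded K_def]] by simp
    then show "x \<in> D \<and> v x = u x"
      using subsetD[OF s(2)[folded K'_def]] v(2) by blast
  qed auto
  then obtain x where "x \<in> ball c r" "h x > h z"
    unfolding h_def by blast
  then show False
    using z(2)[OF subsetD[OF ball_subset_cball, of x]] by simp
qed

section \<open>The continuity principle\<close>

text \<open>The boundaries of the discs \<open>wact m t (f l)\<close>,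
  \<open>0 \<le> t \<le> 1\<close>, stay in a compact subset of \<open>D\<close>. By the maximum
  principle a disc inside \<open>D\<close> lies in a sublevel set with closure inside
  \<open>D\<close>, so inclusion in \<open>D\<close> is open and closed in \<open>t\<close>. As
  \<open>0 ^ 0 = 1\<close>, \<open>wact m 0\<close> keeps the coordinates of weight 0, whence the
  separate hypothesis at \<open>t = 0\<close>.\<close>

lemma pseudoconvex_balanced_disc:
  fixes D :: "(complex ^ 'n) set" and f :: "complex \<Rightarrow> complex ^ 'n"
  assumes bal: "balanced_wrt m D" and pc: "pseudoconvex D"
    and contf: "continuous_on (cball c r) f" and holf: "\<And>i. (\<lambda>l. f l $ i) holomorphic_on ball c r"
    and bd: "\<And>l. l \<in> sphere c r \<Longrightarrow> f l \<in> D"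
    and zero: "\<And>l. l \<in> cball c r \<Longrightarrow> wact m 0 (f l) \<in> D"
    and l: "l \<in> cball c r"
  shows "f l \<in> D"
proof -
  have "open D" using pc by (simp add: pseudoconvex_def domain_Cn_def)
  obtain u where psh: "cont_psh_on u D" and Z: "\<And>k. closure {z\<in>D. u z < k} \<subseteq> D"
    using pc unfolding pseudoconvex_def by blast
  define H where "H = (\<lambda>(t::real, l). wact m (of_real t) (f l))"
  have contH: "continuous_on ({0..1} \<times> cball c r) H"
    unfolding H_def case_prod_unfold
    by (intro continuous_intros continuous_on_compose2[OF contf]) auto
  have Q: "compact (H ` ({0..1} \<times> sphere c r))"
    by (intro compact_continuous_image continuous_on_subset[OF contH] compact_Times) auto
  have "H ` ({0..1} \<times> sphere c r) \<subseteq> D"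
    using balanced_wrt_wact[OF bal bd] by (auto simp: H_def)
  then have "continuous_on (H ` ({0..1} \<times> sphere c r)) u"
    using psh continuous_on_subset unfolding cont_psh_on_def by blast
  from compact_imp_bounded[OF compact_continuous_image[OF this Q]]
  obtain M where M: "\<And>x. x \<in> H ` ({0..1} \<times> sphere c r) \<Longrightarrow> u x \<le> M"
    unfolding bounded_real by (metis abs_le_D1 imageI)
  \<comment> \<open>\<open>A\<close> collects the discs trapped in the closed sublevel set,
    \<open>B\<close> those leaving \<open>D\<close>. Both are closed, they are disjoint, and they
    cover the interval.\<close>
  define A where "A = {t \<in> {0..1}. \<forall>l\<in>cball c r. H (t, l) \<in> closure {z\<in>D. u z < M + 1}}"
  define B where "B = {t \<in> {0..1}. \<exists>l\<in>cball c r. H (t, l) \<notin> D}"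
  have "closed A"
  proof -
    have "closed ((\<lambda>t. H (t, x)) -` closure {z\<in>D. u z < M + 1})" for x
      unfolding H_def by (intro closed_vimage closed_closure) (auto intro!: continuous_intros)
    moreover have "A = {0..1} \<inter> (\<Inter>x\<in>cball c r. (\<lambda>t. H (t, x)) -` closure {z\<in>D. u z < M + 1})"
      by (auto simp: A_def)
    ultimately show ?thesis by auto
  qed
  moreover have "closed B"
  proof -
    have "B = fst ` (({0..1} \<times> cball c r) \<inter> H -` (- D))"
      by (force simp: B_def)
    moreover have "closed (({0..1} \<times> cball c r) \<inter> H -` (- D))"
      by (intro continuous_closed_preimage[OF contH] closed_Times) (use \<open>open D\<close> in auto)
    then have "compact (({0..1} \<times> cball c r) \<inter> (({0..1} \<times> cball c r) \<inter> H -` (- D)))"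
      by (intro compact_Int_closed compact_Times) auto
    then have "compact (fst ` (({0..1} \<times> cball c r) \<inter> H -` (- D)))"
      by (intro compact_continuous_image continuous_intros) (simp add: Int_assoc[symmetric])
    ultimately show ?thesis
      using compact_imp_closed by metis
  qed
  moreover have "A \<inter> B = {}"
    using Z by (auto simp: A_def B_def)
  moreover have "{0..1} \<subseteq> A \<union> B"
  proof
    fix t :: real assume t: "t \<in> {0..1}"
    show "t \<in> A \<union> B"
    proof (cases "t \<in> B")
      case False
      then have inD: "H (t, x) \<in> D" if "x \<in> cball c r" for x
        using that t by (auto simp: B_def)
      have le: "u (H (t, x)) \<le> M" if "x \<in> cball c r" for x
      proof (rule psh_holomorphic_maximum_principle[OF \<open>open D\<close> psh _ _ _ _ that])
        show "continuous_on (cball c r) (\<lambda>x. H (t, x))"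
          by (rule continuous_on_compose2[OF contH]) (use t in \<open>auto intro!: continuous_intros\<close>)
        show "(\<lambda>l. H (t, l) $ i) holomorphic_on ball c r" for i
          unfolding H_def by (auto intro!: holomorphic_intros holf)
        show "(\<lambda>x. H (t, x)) ` cball c r \<subseteq> D" using inD by auto
        show "u (H (t, l)) \<le> M" if "l \<in> sphere c r" for l
          using that t by (intro M imageI) auto
      qed
      have "H (t, x) \<in> {z\<in>D. u z < M + 1}" if "x \<in> cball c r" for x
        using inD[OF that] le[OF that] by simp
      then have "H (t, x) \<in> closure {z\<in>D. u z < M + 1}" if "x \<in> cball c r" for x
        using that closure_subset by blast
      then show ?thesis using t by (simp add: A_def)
    qed simp
  qed
  moreover have "connected {0..1::real}" by simp
  ultimately have "{0..1} \<inter> A = {} \<or> {0..1} \<inter> B = {}"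
    using connected_closedD[of "{0..1::real}" A B] by blast
  moreover have "0 \<notin> B"
    using zero by (auto simp: B_def H_def)
  then have "0 \<in> A"
    using subsetD[OF \<open>{0..1} \<subseteq> A \<union> B\<close>, of 0] by simp
  ultimately have "1 \<notin> B"
    by (metis IntI atLeastAtMost_iff empty_iff order_refl zero_le_one)
  then have "H (1, l) \<in> D" using l by (auto simp: B_def)
  then show ?thesis by (simp add: H_def)
qed

section \<open>Tangent discs, Hopf's barrier and the dichotomy\<close>

text \<open>Connectedness gives a boundary point \<open>b\<close> of \<open>W\<close> inside
  \<open>S\<close>. From a point \<open>a\<close> of \<open>W\<close> close to \<open>b\<close>, the
  nearest point \<open>c\<close> outside \<open>W\<close> yields a ball in \<open>W\<close> touching
  the complement at \<open>c\<close>, as Hopf's argument requires.\<close>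

lemma open_proper_subset_interior_ball:
  fixes S W :: "'a::euclidean_space set"
  assumes "open S" "connected S" "open W" "W \<subseteq> S" "W \<noteq> {}" "W \<noteq> S"
  obtains a c R where "R > 0" "ball a R \<subseteq> W" "c \<notin> W" "dist a c = R" "cball c (R / 2) \<subseteq> S"
proof -
  have "\<not> S \<inter> closure W \<subseteq> W"
  proof
    assume "S \<inter> closure W \<subseteq> W"
    then have "W = S \<inter> closure W" using \<open>W \<subseteq> S\<close> closure_subset by blast
    then have "closedin (top_of_set S) W" by (metis closed_closure closedin_closed_Int)
    moreover have "openin (top_of_set S) W"
      using assms by (simp add: openin_open_eq)
    ultimately show False
      using assms connected_clopen[of S] by blast
  qed
  then obtain b where b: "b \<in> S" "b \<in> closure W" "b \<notin> W" by blast
  obtain d where d: "d > 0" "ball b d \<subseteq> S" using \<open>open S\<close> b openE by blast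
  obtain a where a: "a \<in> W" "dist a b < d / 4"
    using b d closure_approachable[of b W] by (metis divide_pos_pos zero_less_numeral)
  \<comment> \<open>Only the complement near \<open>b\<close> is minimised over. As
    \<open>dist a b\<close> and \<open>dist a c\<close> are below \<open>d / 4\<close>, the ball
    about \<open>a\<close> stays inside \<open>cball b (d / 2)\<close>, so it misses the whole
    complement of \<open>W\<close>.\<close>
  define C where "C = cball b (d / 2) - W"
  have "closed C" "b \<in> C"
    using \<open>open W\<close> b d by (auto simp: C_def intro: closed_Diff)
  then obtain c where c: "c \<in> C" "\<And>y. y \<in> C \<Longrightarrow> dist a c \<le> dist a y"
    using distance_attains_inf[of C a] by blast
  have R: "dist a c < d / 4"
    using c(2)[OF \<open>b \<in> C\<close>] a by linarith
  show ?thesis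
  proof (rule that[of "dist a c" a c])
    show "0 < dist a c" using a c by (auto simp: C_def)
    show "c \<notin> W" using c by (simp add: C_def)
    show "ball a (dist a c) \<subseteq> W"
    proof
      fix p assume p: "p \<in> ball a (dist a c)"
      then have "dist b p \<le> d / 2"
        using R a(2) dist_triangle[of b p a] by (simp add: dist_commute)
      then show "p \<in> W"
        using p c(2)[of p] by (force simp: C_def)
    qed
    show "cball c (dist a c / 2) \<subseteq> S"
    proof
      fix p assume "p \<in> cball c (dist a c / 2)"
      then have "dist c p \<le> dist a c / 2" by simp
      then have "dist b p < d"
        using R a(2) \<open>d > 0\<close> dist_triangle[of b p c] dist_triangle[of b c a] dist_commute[of b a]
        by linarith
      then show "p \<in> S" using d by auto
    qed
  qed simp
qed

text \<open>On the circle of radius \<open>r\<close>, \<open>wact m r (\<phi> x)\<close> is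
  \<open>wact m (r / x)\<close> applied to \<open>wact m x (\<phi> x)\<close>, and
  \<open>r / x\<close> has modulus 1, so balancedness puts the boundary in \<open>D\<close>. The
  continuity principle fills the disc.\<close>

lemma wact_disc_mem:
  fixes D :: "(complex ^ 'n) set"
  assumes bal: "balanced_wrt m D" and pc: "pseudoconvex D" and \<phi>: "holo_disc_map \<phi>"
    and \<psi>: "\<And>l. l \<in> ball 0 1 \<Longrightarrow> wact m l (\<phi> l) \<in> D"
    and l: "l \<in> ball 0 1" and s: "cmod s < 1"
  shows "wact m s (\<phi> l) \<in> D"
proof -
  have zero: "wact m 0 (\<phi> x) \<in> D" if "x \<in> ball 0 1" for x
    using balanced_wrt_wact[OF bal \<psi>[OF that], of 0] by (simp add: wact_wact)
  \<comment> \<open>\<open>cmod l \<le> r\<close> places \<open>l\<close> in the filled disc, and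
    \<open>cmod s \<le> r\<close> lets balancedness pass from \<open>r\<close> to
    \<open>s\<close>.\<close>
  define r where "r = max (cmod s) (cmod l)"
  have r: "cmod s \<le> r" "cmod l \<le> r" "r < 1" using s l by (auto simp: r_def)
  show ?thesis
  proof (cases "r = 0")
    case True
    then show ?thesis using r zero l by simp
  next
    case False
    then have "r > 0" using r norm_ge_zero[of s] by linarith
    have sub: "cball 0 r \<subseteq> ball (0::complex) 1" using r by auto
    have "wact m (of_real r) (\<phi> l) \<in> D"
    proof (rule pseudoconvex_balanced_disc[OF bal pc, of 0 r])
      show "continuous_on (cball 0 r) (\<lambda>l. wact m (of_real r) (\<phi> l))"
        by (intro continuous_intros continuous_on_subset[OF holo_disc_map_imp_continuous_on[OF \<phi>] sub])
      show "(\<lambda>l. wact m (of_real r) (\<phi> l) $ i) holomorphic_on ball 0 r" for i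
      proof -
        have "(\<lambda>l. \<phi> l $ i) holomorphic_on ball 0 r"
          using \<phi> r unfolding holo_disc_map_def
          by (meson holomorphic_on_subset less_imp_le subset_ball)
        then show ?thesis by (auto intro!: holomorphic_intros)
      qed
      show "wact m (of_real r) (\<phi> x) \<in> D" if x: "x \<in> sphere 0 r" for x
      proof -
        have "x \<noteq> 0" using x \<open>r > 0\<close> by auto
        then have "wact m (of_real r) (\<phi> x) = wact m (of_real r / x) (wact m x (\<phi> x))"
          by (simp add: wact_wact)
        moreover have "x \<in> ball 0 1" using x r by simp
        ultimately show ?thesis
          using balanced_wrt_wact[OF bal \<psi>, of x "of_real r / x"] x \<open>r > 0\<close> by (simp add: norm_divide)
      qed
      show "wact m 0 (wact m (of_real r) (\<phi> x)) \<in> D" if "x \<in> cball 0 r" for x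
        using zero[of x] that sub by (auto simp: wact_wact)
      show "l \<in> cball 0 r" using r by simp
    qed
    from balanced_wrt_wact[OF bal this, of "s / of_real r"] show ?thesis
      using r \<open>r > 0\<close> by (simp add: wact_wact norm_divide)
  qed
qed

lemma mem_closure_of_wact:
  assumes "\<And>s. cmod s < 1 \<Longrightarrow> wact m s z \<in> D"
  shows "z \<in> closure D"
proof -
  define X where "X = (\<lambda>n. complex_of_real (real n / real (Suc n)))"
  have "X \<longlonglongrightarrow> of_real 1"
    unfolding X_def by (intro tendsto_of_real LIMSEQ_n_over_Suc_n)
  moreover have "continuous_on UNIV (\<lambda>s. wact m s z)"
    by (intro continuous_intros)
  then have "isCont (\<lambda>s. wact m s z) 1"
    by (simp add: continuous_on_eq_continuous_at)
  ultimately have "(\<lambda>n. wact m (X n) z) \<longlonglongrightarrow> wact m 1 z"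
    using isCont_tendsto_compose[of 1 "\<lambda>s. wact m s z" X] by simp
  moreover have "wact m (X n) z \<in> D" for n
    unfolding X_def by (intro assms) (simp only: norm_of_real, simp)
  ultimately show ?thesis
    unfolding closure_sequential by (auto intro!: exI[of _ "\<lambda>n. wact m (X n) z"])
qed

text \<open>Hopf's barrier: on the circle of radius \<open>R/2\<close> about \<open>0\<close>, the real part of \<open>y + y\<^sup>2/R\<close> is
  negative off a compact arc contained in the disc of radius \<open>R\<close> about \<open>R\<close>.\<close>

lemma Hopf_barrier:
  fixes y :: complex
  assumes "R > 0" and y: "cmod y = R / 2"
  shows "Re y < R / 6 \<Longrightarrow> Re (y + y\<^sup>2 / of_real R) < 0"
    and "Re y \<ge> R / 6 \<Longrightarrow> cmod (y - of_real R) < R"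
proof -
  have n: "(Re y)\<^sup>2 + (Im y)\<^sup>2 = R\<^sup>2 / 4"
    using cmod_power2[of y] unfolding y by (simp add: power_divide)
  show "Re (y + y\<^sup>2 / of_real R) < 0" if "Re y < R / 6"
  proof -
    have "- (R / 2) \<le> Re y"
      using abs_Re_le_cmod[of y] y by linarith
    \<comment> \<open>With \<open>x = Re y\<close>, the real part of \<open>y^2\<close> on the
      circle is \<open>2 * x^2 - R^2 / 4\<close>. Adding a third of \<open>R * x < R^2 / 6\<close>
      to this product inequality bounds \<open>R * x + 2 * x^2 - R^2 / 4\<close> by
      \<open>- R^2 / 36\<close>.\<close>
    then have "2 * (Re y + R / 2) * (Re y - R / 6) \<le> 0"
      using that by (intro mult_nonneg_nonpos) auto
    moreover have "R * Re y < R * (R / 6)"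
      using that \<open>R > 0\<close> by (intro mult_strict_left_mono)
    moreover have "R * R > 0" using \<open>R > 0\<close> by simp
    ultimately have "R * Re y + (2 * (Re y)\<^sup>2 - R\<^sup>2 / 4) < 0"
      by (simp add: power2_eq_square algebra_simps)
    moreover have "R * Re (y + y\<^sup>2 / of_real R) = R * Re y + ((Re y)\<^sup>2 - (Im y)\<^sup>2)"
      using \<open>R > 0\<close> by (simp add: Re_divide_of_real power2_eq_square field_simps)
    ultimately have "R * Re (y + y\<^sup>2 / of_real R) < 0"
      using n by linarith
    then show ?thesis
      using \<open>R > 0\<close> by (simp add: mult_less_0_iff)
  qed
  show "cmod (y - of_real R) < R" if "Re y \<ge> R / 6"
  proof -
    have "(cmod (y - of_real R))\<^sup>2 = (Re y)\<^sup>2 + (Im y)\<^sup>2 - 2 * (R * Re y) + R\<^sup>2"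
      unfolding cmod_power2 by (simp add: power2_eq_square algebra_simps)
    moreover have "R * Re y \<ge> R * (R / 6)"
      using that \<open>R > 0\<close> by (intro mult_left_mono) auto
    moreover have "R * (R / 6) = R\<^sup>2 / 6" "R\<^sup>2 > 0" using \<open>R > 0\<close> by (auto simp: power2_eq_square)
    ultimately have "(cmod (y - of_real R))\<^sup>2 < R\<^sup>2"
      using n by linarith
    then show ?thesis
      using \<open>R > 0\<close> by (simp add: power2_less_imp_less)
  qed
qed

text \<open>At a point \<open>c\<close> where a disc in \<open>W\<close> touches the complement,
  \<open>\<phi>\<close> is twisted by \<open>exp (e * g)\<close>. On the circle of radius
  \<open>R / 2\<close> about \<open>c\<close>, the factor has modulus below 1 off the arc
  \<open>A\<close>; on \<open>A\<close>, \<open>\<phi>\<close> is already in \<open>D\<close> and a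
  small \<open>e\<close> perturbs it little. Since \<open>g c = 0\<close>, filling the disc puts
  \<open>\<phi> c\<close> in \<open>D\<close>.\<close>

lemma disc_map_dichotomy:
  fixes D :: "(complex ^ 'n) set"
  assumes bal: "balanced_wrt m D" and pc: "pseudoconvex D" and \<phi>: "holo_disc_map \<phi>"
    and \<psi>: "\<And>l. l \<in> ball 0 1 \<Longrightarrow> wact m l (\<phi> l) \<in> D"
  shows "\<phi> ` ball 0 1 \<subseteq> D \<or> \<phi> ` ball 0 1 \<inter> D = {}"
proof (rule ccontr)
  assume contra: "\<not> ?thesis"
  have "open D" using pc by (simp add: pseudoconvex_def domain_Cn_def)
  note cont\<phi> = holo_disc_map_imp_continuous_on[OF \<phi>]
  define W where "W = ball 0 1 \<inter> \<phi> -` D"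
  have "open W"
    unfolding W_def using cont\<phi> \<open>open D\<close> by (intro continuous_open_preimage) auto
  have "W \<subseteq> ball 0 1" "W \<noteq> {}" "W \<noteq> ball 0 1"
    using contra by (auto simp: W_def)
  then obtain R a c where R: "R > 0" "ball a R \<subseteq> W" "c \<notin> W" "dist a c = R" "cball c (R / 2) \<subseteq> ball 0 1"
    using open_proper_subset_interior_ball[OF open_ball connected_ball \<open>open W\<close>] by metis
  \<comment> \<open>This unimodular factor rotates \<open>a - c\<close> onto the positive real axis;
    in the coordinate \<open>y\<close> the tangent disc has radius \<open>R\<close> and centre
    \<open>R\<close>.\<close>
  define \<tau> where "\<tau> = cnj (a - c) / of_real R"
  have \<tau>: "cmod \<tau> = 1" using R by (simp add: \<tau>_def norm_divide dist_norm del: complex_cnj_diff)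
  define y where "y = (\<lambda>l. \<tau> * (l - c))"
  have ya: "cmod (y l - of_real R) = cmod (l - a)" for l
  proof -
    have "\<tau> * (a - c) = of_real R"
    proof -
      have "\<tau> * (a - c) = of_real ((cmod (a - c))\<^sup>2 / R)"
        unfolding \<tau>_def of_real_divide complex_norm_square by (simp add: mult.commute)
      then show ?thesis using R by (simp add: dist_norm power2_eq_square)
    qed
    then have "y l - of_real R = \<tau> * (l - a)"
      by (simp add: y_def algebra_simps)
    then show ?thesis using \<tau> by (simp add: norm_mult)
  qed
  define g where "g = (\<lambda>l. y l + (y l)\<^sup>2 / of_real R)"
  define A where "A = sphere c (R / 2) \<inter> {l. Re (y l) \<ge> R / 6}"
  have yn: "cmod (y l) = R / 2" if "l \<in> sphere c (R / 2)" for l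
    using that \<tau> by (simp add: y_def norm_mult dist_norm norm_minus_commute)
  have AW: "A \<subseteq> W"
  proof
    fix l assume "l \<in> A"
    then have "cmod (l - a) < R"
      using Hopf_barrier(2)[OF R(1) yn] by (simp add: A_def ya)
    then show "l \<in> W"
      using R(2) by (auto simp: dist_norm norm_minus_commute)
  qed
  have "compact A"
    unfolding A_def y_def
    by (intro compact_Int_closed closed_Collect_le continuous_intros) auto
  define h where "h = (\<lambda>(e::real, l). wact m (exp (of_real e * g l)) (\<phi> l))"
  have "continuous_on ({0..1} \<times> A) h"
    unfolding h_def case_prod_unfold g_def y_def
    by (intro continuous_intros continuous_on_compose2[OF cont\<phi>]) (use AW R in \<open>auto simp: W_def\<close>)
  then have unif: "uniformly_continuous_on ({0..1} \<times> A) h"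
    using \<open>compact A\<close> by (intro compact_uniformly_continuous compact_Times) auto
  have "compact (\<phi> ` A)" "\<phi> ` A \<subseteq> D"
    using AW \<open>compact A\<close> by (auto simp: W_def intro!: compact_continuous_image continuous_on_subset[OF cont\<phi>])
  then obtain \<eta> where \<eta>: "\<eta> > 0" "(\<Union>x\<in>\<phi> ` A. ball x \<eta>) \<subseteq> D"
    using compact_subset_open_imp_ball_epsilon_subset[OF _ \<open>open D\<close>] by metis
  obtain \<delta> where \<delta>: "\<delta> > 0" "\<And>x x'. x \<in> {0..1} \<times> A \<Longrightarrow> x' \<in> {0..1} \<times> A \<Longrightarrow> dist x' x < \<delta> \<Longrightarrow> dist (h x') (h x) < \<eta>"
    using unif \<eta>(1) unfolding uniformly_continuous_on_def by metis
  define e where "e = min 1 (\<delta> / 2)"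
  have e: "0 < e" "e \<le> 1" "e < \<delta>" using \<delta> by (auto simp: e_def)
  have hA: "h (e, l) \<in> D" if "l \<in> A" for l
  proof -
    have "dist (h (e, l)) (h (0, l)) < \<eta>"
      using that e by (intro \<delta>(2)) (auto simp: dist_Pair_Pair)
    then have "h (e, l) \<in> ball (\<phi> l) \<eta>"
      by (simp add: h_def dist_commute)
    then show ?thesis using \<eta>(2) that by blast
  qed
  have "wact m (exp (of_real e * g c)) (\<phi> c) \<in> D"
  proof (rule pseudoconvex_balanced_disc[OF bal pc, of c "R / 2"])
    show "continuous_on (cball c (R / 2)) (\<lambda>l. wact m (exp (of_real e * g l)) (\<phi> l))"
      unfolding g_def y_def
      by (intro continuous_intros continuous_on_subset[OF cont\<phi>]) (use R in auto)
    show "(\<lambda>l. wact m (exp (of_real e * g l)) (\<phi> l) $ i) holomorphic_on ball c (R / 2)" for i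
    proof -
      have "(\<lambda>l. \<phi> l $ i) holomorphic_on ball c (R / 2)"
        using \<phi> R(5) ball_subset_cball unfolding holo_disc_map_def
        by (meson holomorphic_on_subset order_trans)
      then show ?thesis
        unfolding g_def y_def using R by (auto intro!: holomorphic_intros)
    qed
    show "wact m (exp (of_real e * g l)) (\<phi> l) \<in> D" if l: "l \<in> sphere c (R / 2)" for l
    proof (cases "l \<in> A")
      case True
      then show ?thesis using hA by (simp add: h_def)
    next
      case False
      then have "Re (g l) < 0"
        using Hopf_barrier(1)[OF R(1) yn[OF l]] l by (simp add: A_def g_def)
      then have "cmod (exp (of_real e * g l)) < 1"
        using e by (simp add: mult_pos_neg)
      moreover have "l \<in> ball 0 1" using l R(5) sphere_cball by blast
      ultimately show ?thesis
        using wact_disc_mem[OF bal pc \<phi> \<psi>] by blast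
    qed
    show "wact m 0 (wact m (exp (of_real e * g l)) (\<phi> l)) \<in> D" if "l \<in> cball c (R / 2)" for l
    proof -
      have "l \<in> ball 0 1" using that R(5) by blast
      then show ?thesis
        using wact_disc_mem[OF bal pc \<phi> \<psi>, of l 0] by (simp add: wact_wact)
    qed
    show "c \<in> cball c (R / 2)" using R by simp
  qed
  then have "\<phi> c \<in> D" by (simp add: g_def y_def)
  moreover have "c \<in> ball 0 1" using R(1,5) by (meson centre_in_cball half_gt_zero less_imp_le subsetD)
  ultimately show False using R(3) by (simp add: W_def)
qed

theorem theorem3:
  fixes m :: "'n::finite \<Rightarrow> nat" and D :: "(complex ^ 'n) set"
    and \<phi> :: "complex \<Rightarrow> complex ^ 'n"
  assumes "\<exists>i. m i \<noteq> 0"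
    and "balanced_wrt m D" and "pseudoconvex D"
    and "holo_disc_map \<phi>"
    and "complex_geodesic D (\<lambda>l. \<chi> i. l ^ m i * \<phi> l $ i)"
  shows "\<phi> ` ball 0 1 \<subseteq> frontier D \<or> complex_geodesic D \<phi>"
proof -
  have geo: "complex_geodesic D (\<lambda>l. wact m l (\<phi> l))"
    using assms(5) by (simp add: wact_def)
  have "open D" using assms(3) by (simp add: pseudoconvex_def domain_Cn_def)
  have \<psi>: "wact m l (\<phi> l) \<in> D" if "l \<in> ball 0 1" for l
    using geo that unfolding complex_geodesic_def by blast
  have cl: "\<phi> l \<in> closure D" if "l \<in> ball 0 1" for l
    using wact_disc_mem[OF assms(2-4) \<psi> that] by (rule mem_closure_of_wact)
  consider "\<phi> ` ball 0 1 \<subseteq> D" | "\<phi> ` ball 0 1 \<inter> D = {}"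
    using disc_map_dichotomy[OF assms(2-4) \<psi>] by blast
  then show ?thesis
  proof cases
    case 1
    then show ?thesis
      using complex_geodesic_wact_cancel[OF \<open>open D\<close> assms(2,4) _ geo] by blast
  next
    case 2
    then show ?thesis
      using cl \<open>open D\<close> unfolding frontier_def by (auto simp: interior_open)
  qed
qed

end
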